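(* Let $f:\mathbb{D}\to\mathbb{C}$ be analytic. (i) Then $f\in\mathcal{B}$ if and only if $e^{\delta\operatorname{Re}(f)}$ is a $B_2$-weight for some $\delta>0$. (ii) Then $f\in\mathcal{B}_0$ if and only if $$\lim_{\delta\to0+}\ \sup_{A(Q)<\delta}\Big(\frac1{A(Q)}\int_Q e^{\operatorname{Re}(f)}\,dA\Big)\Big(\frac1{A(Q)}\int_Q e^{-\operatorname{Re}(f)}\,dA\Big)=1,$$ where the supremum is taken over all Carleson squares $Q\subset\mathbb{D}$ with $A(Q)<\delta$.
   Context: $\mathbb{D}$ is the open unit disc, $\partial\mathbb{D}$ the unit circle, $m$ is Lebesgue measure on $\partial\mathbb{D}$, $dA$ is normalized Lebesgue area measure on $\mathbb{D}$. The Bloch space $\mathcal{B}$ is the space of analytic functions $g$ on $\mathbb{D}$ with $\|g\|_{\mathcal{B}}=\sup_{z\in\mathbb{D}}(1-|z|^2)|g'(z)|<\infty$. The little Bloch space $\mathcal{B}_0$ consists of those $g\in\mathcal{B}$ with $\lim_{|z|\to1-}(1-|z|^2)|g'(z)|=0$. Carleson squares are the sets $Q_I=\{z\in\mathbb{D}\setminus\{0\}: z/|z|\in I,\ 1-|z|<m(I)\}$, for arcs $I\subset\partial\mathbb{D}$. A positive integrable function $w$ on $\mathbb{D}$ is a $B_2$-weight if $$[w]_{B_2}^2=\sup_I\Big(\frac1{A(Q_I)}\int_{Q_I}w\,dA\Big)\Big(\frac1{A(Q_I)}\int_{Q_I}w^{-1}\,dA\Big)<\infty,$$ the supremum being over all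 arcs $I\subset\partial\mathbb{D}$. *)

theory Defs
  imports "HOL-Complex_Analysis.Complex_Analysis"
begin

abbreviation unit_disc :: "complex set" where
  "unit_disc \<equiv> ball 0 1"

definition bloch_seminorm :: "(complex \<Rightarrow> complex) \<Rightarrow> ennreal" where
  "bloch_seminorm g = (SUP z\<in>unit_disc. ennreal ((1 - (cmod z)\<^sup>2) * cmod (deriv g z)))"

definition bloch :: "(complex \<Rightarrow> complex) set" where
  "bloch = {g. g holomorphic_on unit_disc \<and> bloch_seminorm g < \<infinity>}"

definition little_bloch :: "(complex \<Rightarrow> complex) set" where
  "little_bloch = {g \<in> bloch.
     ((\<lambda>z. (1 - (cmod z)\<^sup>2) * cmod (deriv g z)) \<longlongrightarrow> 0) (filtercomap cmod (at_left 1))}"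

text \<open>Arc length, of total mass \<open>2 * pi\<close>; only the area measure is normalized.\<close>

definition circle_measure :: "complex measure" where
  "circle_measure = distr (restrict_space lborel {0..<2 * pi}) borel cis"

text \<open>The measure lives on the disc only, so that the values of a function outside the disc
  do not affect its measurability.\<close>

definition disc_area :: "complex measure" where
  "disc_area = uniform_measure (lebesgue_on unit_disc) unit_disc"

text \<open>Nondegenerate arcs, with or without either endpoint, up to and including the full circle.\<close>

definition circle_arcs :: "complex set set" where
  "circle_arcs = {cis ` S | S a b. a < b \<and> b \<le> a + 2 * pi \<and> {a<..<b} \<subseteq> S \<and> S \<subseteq> {a..b}}"

definition carleson_square :: "complex set \<Rightarrow> complex set" where
  "carleson_square I =
     {z \<in> unit_disc - {0}. z / of_real (cmod z) \<in> I \<and> 1 - cmod z < measure circle_measure I}"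

definition carleson_squares :: "complex set set" where
  "carleson_squares = carleson_square ` circle_arcs"

text \<open>Averages take values in \<open>[0, \<infinity>]\<close>: a nonintegrable function has average \<open>\<infinity>\<close>.\<close>

definition area_average :: "complex set \<Rightarrow> (complex \<Rightarrow> real) \<Rightarrow> ennreal" where
  "area_average Q w = (\<integral>\<^sup>+z\<in>Q. ennreal (w z) \<partial>disc_area) / emeasure disc_area Q"

text \<open>The square of the \<open>B\<^sub>2\<close> characteristic of \<open>w\<close>.\<close>

definition B2_char_sq :: "(complex \<Rightarrow> real) \<Rightarrow> ennreal" where
  "B2_char_sq w =
     (SUP I\<in>circle_arcs. area_average (carleson_square I) w *
                        area_average (carleson_square I) (\<lambda>z. inverse (w z)))"

definition B2_weight :: "(complex \<Rightarrow> real) \<Rightarrow> bool" where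
  "B2_weight w \<longleftrightarrow>
     (\<forall>z\<in>unit_disc. 0 < w z) \<and> integrable disc_area w \<and> B2_char_sq w < \<infinity>"

end

theory Submission
  imports Defs "HOL-Library.Real_Mod"
begin

text \<open>If \<open>(1 - \<bar>z\<bar>) \<bar>f'(z)\<bar> \<le> K\<close> on the part of the disc that \<open>Q\<^sub>I\<close> lives in, then integrating
  \<open>f'\<close> along a chord and then a radius shows that \<open>f\<close> differs from its value \<open>c\<close> at the top of \<open>Q\<^sub>I\<close> by at most
  \<open>K (1 / 2 + ln (l / (1 - \<bar>z\<bar>)))\<close> with \<open>l = min 1 (m I)\<close>. Hence \<open>exp (\<plusminus> Re (f - c))\<close> is at most
  \<open>exp (K / 2) (l / (1 - \<bar>z\<bar>)) powr K\<close>, and convexity of \<open>exp\<close> reduces its average over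
  \<open>Q\<^sub>I\<close> to that of \<open>sqrt (l / (1 - \<bar>z\<bar>))\<close>: the product of the two averages is \<open>1 + O(K)\<close>.

  Conversely, let \<open>p\<close> be the product of the averages of \<open>exp u\<close> and \<open>exp (- u)\<close> over \<open>Q\<close>, with
  \<open>u = Re f\<close>, and let \<open>exp c\<close> be the average of \<open>exp u\<close>. The average of
  \<open>exp (u - c) + exp (c - u) - 2\<close> is then \<open>p - 1\<close>. This function dominates \<open>(u - c)\<^sup>2\<close>, so it
  is nonnegative and the integral can be restricted to a disc inside \<open>Q\<close> of comparable area; there
  Cauchy's formula bounds the mean square of \<open>u - c\<close> from below by \<open>\<bar>f'\<bar>\<^sup>2\<close> times the square of
  the radius. So \<open>(1 - \<bar>z\<bar>) \<bar>f'(z)\<bar> = O(sqrt (p - 1))\<close>, which serves both parts.\<close>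

section \<open>Integration in polar coordinates\<close>

(* This notation would clash with that of vector components. *)
no_notation fps_nth (infixl \<open>$\<close> 75)

text \<open>Determinants and the change of variables formula live on \<open>real^'n\<close>, so
  polar coordinates are set up on \<open>real^2\<close> first and carried over to
  \<open>complex\<close> in \<open>lborel_complex_eq_polar\<close>.\<close>

lemma has_derivative_polar_map:
  fixes v :: "real^2"
  shows "((\<lambda>v::real^2. vector [v$1 * cos (v$2), v$1 * sin (v$2)] :: real^2) has_derivative
     (\<lambda>h. vector [h$1 * cos (v$2) - v$1 * sin (v$2) * h$2, h$1 * sin (v$2) + v$1 * cos (v$2) * h$2]))
     (at v within S)"
proof (subst has_derivative_componentwise_within, intro ballI)
  have nth: "((\<lambda>v::real^2. v $ k) has_derivative (\<lambda>h. h $ k)) (at v within S)" for k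
    by (rule bounded_linear_imp_has_derivative) (rule bounded_linear_vec_nth)
  fix i :: "real^2" assume "i \<in> Basis"
  then have "i = axis 1 1 \<or> i = axis 2 1"
    by (auto simp: Basis_vec_def UNIV_2)
  then show "((\<lambda>v. (vector [v$1 * cos (v$2), v$1 * sin (v$2)] :: real^2) \<bullet> i) has_derivative
     (\<lambda>h. vector [h$1 * cos (v$2) - v$1 * sin (v$2) * h$2, h$1 * sin (v$2) + v$1 * cos (v$2) * h$2] \<bullet> i))
     (at v within S)"
    unfolding inner_axis
  proof (elim disjE; simp only: vector_2 inner_axis inner_real_def mult_1_right)
    show "((\<lambda>v::real^2. v$1 * cos (v$2)) has_derivative
        (\<lambda>h. h$1 * cos (v$2) - v$1 * sin (v$2) * h$2)) (at v within S)"
      by (rule has_derivative_eq_rhs, rule has_derivative_mult, rule nth,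
          rule has_derivative_cos, rule nth) (simp add: fun_eq_iff)
    show "((\<lambda>v::real^2. v$1 * sin (v$2)) has_derivative
        (\<lambda>h. h$1 * sin (v$2) + v$1 * cos (v$2) * h$2)) (at v within S)"
      by (rule has_derivative_eq_rhs, rule has_derivative_mult, rule nth,
          rule has_derivative_sin, rule nth) (simp add: fun_eq_iff)
  qed
qed

lemma det_polar_map:
  "det (matrix (\<lambda>h::real^2. vector [h$1 * cos t - r * sin t * h$2, h$1 * sin t + r * cos t * h$2] :: real^2)) = r"
proof -
  have "r * (cos t)\<^sup>2 + r * (sin t)\<^sup>2 = r"
    by (simp flip: distrib_left)
  then show ?thesis
    by (simp add: det_2 matrix_def axis_def algebra_simps power2_eq_square)
qed

lemma borel_measurable_vector_2 [measurable]:
  fixes f g :: "'a \<Rightarrow> real"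
  assumes [measurable]: "f \<in> borel_measurable M" "g \<in> borel_measurable M"
  shows "(\<lambda>x. vector [f x, g x] :: real^2) \<in> borel_measurable M"
proof (rule borel_measurable_euclidean_space[THEN iffD2], intro ballI)
  fix i :: "real^2" assume "i \<in> Basis"
  then have "i = axis 1 1 \<or> i = axis 2 1"
    by (auto simp: Basis_vec_def UNIV_2)
  then show "(\<lambda>x. vector [f x, g x] \<bullet> i) \<in> borel_measurable M"
    by (elim disjE; simp add: inner_axis)
qed

text \<open>Lebesgue measure is determined by its values on boxes. This is the bridge from
  \<open>real^2\<close> to pairs, where integrals can be iterated.\<close>

lemma lborel_real_2_eq_distr:
  "(lborel :: (real^2) measure) = distr (lborel \<Otimes>\<^sub>M lborel) borel (\<lambda>(x, y). vector [x, y])"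
proof (rule lborel_eqI)
  have m: "(\<lambda>(x, y). vector [x, y] :: real^2) \<in> borel_measurable (lborel \<Otimes>\<^sub>M lborel)"
    by (simp add: case_prod_beta borel_measurable_vector_2)
  fix l u :: "real^2"
  assume le: "\<And>b. b \<in> Basis \<Longrightarrow> l \<bullet> b \<le> u \<bullet> b"
  have le': "l $ i \<le> u $ i" for i
    using le[of "axis i 1"] by (simp add: inner_axis axis_in_Basis_iff)
  have eq: "(\<lambda>(x, y). vector [x, y] :: real^2) -` box l u \<inter> space (lborel \<Otimes>\<^sub>M lborel)
     = {l$1<..<u$1} \<times> {l$2<..<u$2}"
    by (auto simp: mem_box_cart forall_2 space_pair_measure)
  have "emeasure (distr (lborel \<Otimes>\<^sub>M lborel) borel (\<lambda>(x, y). vector [x, y])) (box l u)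
      = emeasure (lborel \<Otimes>\<^sub>M lborel) ({l$1<..<u$1} \<times> {l$2<..<u$2})"
    by (subst emeasure_distr[OF m]) (auto simp: eq)
  also have "\<dots> = ennreal ((u$1 - l$1) * (u$2 - l$2))"
    using le' by (subst lborel.emeasure_pair_measure_Times) (auto simp: ennreal_mult)
  also have "(u$1 - l$1) * (u$2 - l$2) = (\<Prod>b\<in>Basis. (u - l) \<bullet> b)"
    by (simp add: Basis_vec_def UNIV_2 inner_axis axis_eq_axis algebra_simps)
  finally show "emeasure (distr (lborel \<Otimes>\<^sub>M lborel) borel (\<lambda>(x, y). vector [x, y])) (box l u)
     = (\<Prod>b\<in>Basis. (u - l) \<bullet> b)" .
qed simp

lemma cis_eq_cis_iff: "cis x = cis y \<longleftrightarrow> (\<exists>n::int. x = y + 2 * pi * of_int n)"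
proof
  assume "cis x = cis y"
  then have "[y = x] (rmod (2 * pi))" by (metis cis_eq_iff)
  then show "\<exists>n::int. x = y + 2 * pi * of_int n"
    by (auto simp: rcong_altdef mult_ac)
next
  assume "\<exists>n::int. x = y + 2 * pi * of_int n"
  then have "[y = x] (rmod (2 * pi))"
    by (auto simp: rcong_altdef mult_ac)
  then show "cis x = cis y" by (metis cis_eq_iff)
qed

lemma nn_integral_lborel_real_2:
  fixes h :: "real^2 \<Rightarrow> ennreal"
  assumes "h \<in> borel_measurable borel"
  shows "(\<integral>\<^sup>+v. h v \<partial>lborel) = (\<integral>\<^sup>+x. h (vector [fst x, snd x]) \<partial>(lborel \<Otimes>\<^sub>M lborel))"
proof -
  have "(\<lambda>(x, y). vector [x, y] :: real^2) \<in> borel_measurable (lborel \<Otimes>\<^sub>M lborel)"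
    by (simp add: case_prod_beta borel_measurable_vector_2)
  then show ?thesis
    by (subst lborel_real_2_eq_distr, subst nn_integral_distr) (use assms in \<open>auto simp: case_prod_beta\<close>)
qed

definition polar_map :: "real^2 \<Rightarrow> real^2" where
  "polar_map v = vector [v$1 * cos (v$2), v$1 * sin (v$2)]"

text \<open>Half-open in the angle, so that \<open>polar_map\<close> is injective here and omits
  only the origin.\<close>

definition polar_domain :: "(real^2) set" where
  "polar_domain = {v. 0 < v$1 \<and> 0 \<le> v$2 \<and> v$2 < 2 * pi}"

lemma inj_on_polar_map: "inj_on polar_map polar_domain"
proof (rule inj_onI)
  fix v w assume v: "v \<in> polar_domain" and w: "w \<in> polar_domain" and eq: "polar_map v = polar_map w"
  have e: "rcis (v$1) (v$2) = rcis (w$1) (w$2)"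
    using eq by (auto simp: polar_map_def vec_eq_iff forall_2 complex_eq_iff)
  from arg_cong[OF e, of cmod] have 1: "v$1 = w$1"
    using v w by (simp add: polar_domain_def)
  with e v have "cis (v$2) = cis (w$2)"
    by (simp add: rcis_def polar_domain_def)
  then obtain n :: int where n: "v$2 = w$2 + 2 * pi * of_int n"
    by (auto simp: cis_eq_cis_iff)
  have "\<bar>2 * pi * of_int n\<bar> < 2 * pi"
    using v w n by (auto simp: polar_domain_def)
  then have "n = 0"
    by (simp add: abs_mult)
  with n 1 show "v = w"
    by (simp add: vec_eq_iff forall_2)
qed

lemma polar_map_image: "polar_map ` polar_domain = - {0}"
proof (intro equalityI subsetI)
  fix w assume "w \<in> polar_map ` polar_domain"
  then obtain v where v: "v \<in> polar_domain" "w = polar_map v" by auto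
  have "(w$1)\<^sup>2 + (w$2)\<^sup>2 = (v$1)\<^sup>2"
    using v by (simp add: polar_map_def power_mult_distrib flip: distrib_left)
  with v show "w \<in> - {0}" by (auto simp: polar_domain_def)
next
  fix w :: "real^2" assume w: "w \<in> - {0}"
  define z where "z = Complex (w$1) (w$2)"
  have "z \<noteq> 0" using w by (auto simp: z_def complex_eq_iff vec_eq_iff forall_2)
  obtain t where t: "0 \<le> t" "t < 2 * pi" "z = cmod z * exp (\<i> * of_real t)"
    using Arg2pi[of z] by (auto simp: is_Arg_def)
  have z: "z = rcis (cmod z) t"
    using t(3) by (simp add: rcis_def cis_conv_exp)
  have "w = polar_map (vector [cmod z, t])"
    using arg_cong[OF z, of Re] arg_cong[OF z, of Im]
    by (simp add: z_def polar_map_def vec_eq_iff forall_2)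
  moreover have "vector [cmod z, t] \<in> polar_domain"
    using t \<open>z \<noteq> 0\<close> by (simp add: polar_domain_def)
  ultimately show "w \<in> polar_map ` polar_domain" by blast
qed

lemma borel_measurable_polar_map [measurable]: "polar_map \<in> borel_measurable borel"
  unfolding polar_map_def by measurable

lemma sets_polar_domain [measurable]: "polar_domain \<in> sets borel"
  unfolding polar_domain_def by measurable

text \<open>Change of variables on the preimage of the box, with Jacobian determinant
  \<open>v$1\<close>; the image misses at most the origin, a null set. Boxes are all that
  \<open>lborel_eqI\<close> asks for.\<close>

lemma nn_integral_polar_box:
  fixes l u :: "real^2"
  shows "(\<integral>\<^sup>+v. ennreal (v$1) * indicator (polar_domain \<inter> polar_map -` box l u) v \<partial>lborel)
     = emeasure lborel (box l u)"
proof -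
  let ?S = "polar_domain \<inter> polar_map -` box l u"
  have S[measurable]: "?S \<in> sets borel"
    using measurable_sets_borel[OF borel_measurable_polar_map, of "box l u"]
    by auto
  have im: "polar_map ` ?S = box l u - {0}"
  proof -
    have "polar_map ` ?S = polar_map ` polar_domain \<inter> box l u" by auto
    then show ?thesis by (auto simp: polar_map_image)
  qed
  have meas: "measure lebesgue (box l u - {0}) = measure lborel (box l u)"
    by (subst measure_Diff_null_set) auto
  have "(\<lambda>v. \<bar>det (matrix (\<lambda>h::real^2. vector [h$1 * cos (v$2) - v$1 * sin (v$2) * h$2,
           h$1 * sin (v$2) + v$1 * cos (v$2) * h$2] :: real^2))\<bar>) integrable_on ?S
        \<and> integral ?S (\<lambda>v. \<bar>det (matrix (\<lambda>h::real^2. vector [h$1 * cos (v$2) - v$1 * sin (v$2) * h$2,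
           h$1 * sin (v$2) + v$1 * cos (v$2) * h$2] :: real^2))\<bar>) = measure lborel (box l u)"
    unfolding has_integral_iff[symmetric]
  proof (subst has_measure_differentiable_image[symmetric, where f = polar_map])
    show "?S \<in> sets lebesgue" using S by simp
    show "inj_on polar_map ?S" using inj_on_polar_map by (rule inj_on_subset) auto
    show "polar_map ` ?S \<in> lmeasurable \<and> measure lebesgue (polar_map ` ?S) = measure lborel (box l u)"
      unfolding im meas
      by (intro conjI refl bounded_set_imp_lmeasurable) (auto intro: bounded_diff)
  qed (unfold polar_map_def, rule has_derivative_polar_map)
  then have "((\<lambda>v. \<bar>v$1\<bar>) has_integral measure lborel (box l u)) ?S"
    by (simp add: det_polar_map has_integral_iff)
  then have "((\<lambda>v. v$1) has_integral measure lborel (box l u)) ?S"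
    by (rule has_integral_eq[rotated]) (auto simp: polar_domain_def)
  then have "((\<lambda>v. if v \<in> ?S then v$1 else 0) has_integral measure lborel (box l u)) UNIV"
    by (simp only: has_integral_restrict_UNIV)
  then have "(\<integral>\<^sup>+v. ennreal (if v \<in> ?S then v$1 else 0) \<partial>lborel) = measure lborel (box l u)"
    by (intro nn_integral_has_integral_lborel) (auto simp: polar_domain_def)
  also have "(\<lambda>v. ennreal (if v \<in> ?S then v$1 else 0)) = (\<lambda>v. ennreal (v$1) * indicator ?S v)"
    by (auto simp: fun_eq_iff)
  finally show ?thesis
    using emeasure_eq_ennreal_measure[of lborel "box l u"] emeasure_lborel_box_finite[of l u]
    by (simp del: emeasure_lborel_box_finite)
qed

text \<open>The two measures are compared on boxes only, and there the claim is
  \<open>nn_integral_polar_box\<close> read through the identification of \<open>complex\<close>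
  with \<open>real^2\<close>.\<close>

lemma lborel_complex_eq_polar:
  "(lborel :: complex measure) =
     distr (density (lborel \<Otimes>\<^sub>M lborel) (\<lambda>x. ennreal (fst x) * indicator ({0<..} \<times> {0..<2 * pi}) x)) borel
       (\<lambda>x. rcis (fst x) (snd x))"
proof (rule lborel_eqI)
  fix l u :: complex assume le: "\<And>b. b \<in> Basis \<Longrightarrow> l \<bullet> b \<le> u \<bullet> b"
  define B where "B = box (vector [Re l, Im l]) (vector [Re u, Im u] :: real^2)"
  have B: "polar_map (vector [r, t]) \<in> B \<longleftrightarrow> rcis r t \<in> box l u" for r t
    by (auto simp: B_def mem_box_cart forall_2 polar_map_def in_box_complex_iff)
  have dom: "vector [r, t] \<in> polar_domain \<longleftrightarrow> (r, t) \<in> {0<..} \<times> {0..<2 * pi}" for r t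
    by (auto simp: polar_domain_def)
  have [measurable]: "B \<in> sets borel" by (simp add: B_def)
  have m[measurable]: "(\<lambda>x. rcis (fst x) (snd x)) \<in> borel_measurable (lborel \<Otimes>\<^sub>M lborel)"
    unfolding borel_prod[symmetric] lborel_prod
    by (simp, intro borel_measurable_continuous_onI continuous_intros)
  have "emeasure lborel B = (\<Prod>b\<in>Basis. (u - l) \<bullet> b)"
  proof -
    have "emeasure lborel B = (\<Prod>b\<in>Basis. (vector [Re u, Im u] - vector [Re l, Im l] :: real^2) \<bullet> b)"
      unfolding B_def using le[of 1] le[of \<i>]
      by (intro emeasure_lborel_box) (auto simp: Basis_vec_def UNIV_2 inner_axis)
    also have "\<dots> = (\<Prod>b\<in>Basis. (u - l) \<bullet> b)"
      by (simp add: Basis_vec_def UNIV_2 inner_axis axis_eq_axis Basis_complex_def algebra_simps)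
    finally show ?thesis .
  qed
  moreover have "emeasure lborel B = (\<integral>\<^sup>+v. ennreal (v$1) * indicator (polar_domain \<inter> polar_map -` B) v \<partial>lborel)"
    by (simp add: B_def nn_integral_polar_box)
  moreover have "\<dots> = (\<integral>\<^sup>+x. ennreal (fst x) * indicator ({0<..} \<times> {0..<2 * pi}) x *
       indicator ((\<lambda>x. rcis (fst x) (snd x)) -` box l u \<inter> space (lborel \<Otimes>\<^sub>M lborel)) x \<partial>(lborel \<Otimes>\<^sub>M lborel))"
    by (subst nn_integral_lborel_real_2)
       (auto intro!: nn_integral_cong simp: indicator_def B dom space_pair_measure
         measurable_sets_borel[OF borel_measurable_polar_map, simplified])
  ultimately show "emeasure (distr (density (lborel \<Otimes>\<^sub>M lborel) 
      (\<lambda>x. ennreal (fst x) * indicator ({0<..} \<times> {0..<2 * pi}) x)) borel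
       (\<lambda>x. rcis (fst x) (snd x))) (box l u) = (\<Prod>b\<in>Basis. (u - l) \<bullet> b)"
    by (subst emeasure_distr, simp, simp, subst emeasure_density)
       (simp_all only: sets_density space_density measurable_sets[OF m] sets_lborel borel_open open_box, auto)
qed simp

lemma nn_integral_polar_pair:
  fixes g :: "complex \<Rightarrow> ennreal"
  assumes [measurable]: "g \<in> borel_measurable borel"
  shows "(\<integral>\<^sup>+z. g z \<partial>lborel) = (\<integral>\<^sup>+x. ennreal (fst x) * indicator ({0<..} \<times> {0..<2 * pi}) x *
      g (rcis (fst x) (snd x)) \<partial>(lborel \<Otimes>\<^sub>M lborel))"
    and "(\<lambda>x. ennreal (fst x) * indicator ({0<..} \<times> {0..<2 * pi}) x * g (rcis (fst x) (snd x)))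
      \<in> borel_measurable (lborel \<Otimes>\<^sub>M lborel)"
proof -
  have [measurable]: "(\<lambda>x. rcis (fst x) (snd x)) \<in> borel_measurable (lborel \<Otimes>\<^sub>M lborel)"
    unfolding borel_prod[symmetric] lborel_prod
    by (simp, intro borel_measurable_continuous_onI continuous_intros)
  show "(\<integral>\<^sup>+z. g z \<partial>lborel) = (\<integral>\<^sup>+x. ennreal (fst x) * indicator ({0<..} \<times> {0..<2 * pi}) x *
      g (rcis (fst x) (snd x)) \<partial>(lborel \<Otimes>\<^sub>M lborel))"
    by (subst lborel_complex_eq_polar, subst nn_integral_distr) (auto simp: nn_integral_density)
  show "(\<lambda>x. ennreal (fst x) * indicator ({0<..} \<times> {0..<2 * pi}) x * g (rcis (fst x) (snd x)))
      \<in> borel_measurable (lborel \<Otimes>\<^sub>M lborel)"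
    by simp
qed

lemma borel_measurable_rcis [measurable]:
  "(\<lambda>t. rcis r t) \<in> borel_measurable borel" "(\<lambda>r. rcis r t) \<in> borel_measurable borel"
  by (intro borel_measurable_continuous_onI continuous_intros)+

text \<open>The radius is the inner variable, which suits Carleson squares: the radial range is the
  same for every angle in the arc.\<close>

lemma nn_integral_polar:
  fixes g :: "complex \<Rightarrow> ennreal"
  assumes [measurable]: "g \<in> borel_measurable borel"
  shows "(\<integral>\<^sup>+z. g z \<partial>lborel) =
     (\<integral>\<^sup>+t\<in>{0..<2 * pi}. (\<integral>\<^sup>+r\<in>{0<..}. ennreal r * g (rcis r t) \<partial>lborel) \<partial>lborel)"
  unfolding nn_integral_polar_pair(1)[OF assms]
    lborel_pair.nn_integral_snd[OF nn_integral_polar_pair(2)[OF assms], symmetric]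
  by (intro nn_integral_cong) (auto simp: indicator_def intro!: nn_integral_cong)

text \<open>The angle is the inner variable, so that estimates on circles can be integrated over the
  radius.\<close>

lemma nn_integral_polar':
  fixes g :: "complex \<Rightarrow> ennreal"
  assumes [measurable]: "g \<in> borel_measurable borel"
  shows "(\<integral>\<^sup>+z. g z \<partial>lborel) =
     (\<integral>\<^sup>+r\<in>{0<..}. ennreal r * (\<integral>\<^sup>+t\<in>{0..<2 * pi}. g (rcis r t) \<partial>lborel) \<partial>lborel)"
proof -
  have "(\<integral>\<^sup>+z. g z \<partial>lborel) = (\<integral>\<^sup>+r. (\<integral>\<^sup>+t. ennreal r * indicator {0<..} r *
      (g (rcis r t) * indicator {0..<2 * pi} t) \<partial>lborel) \<partial>lborel)"
    unfolding nn_integral_polar_pair(1)[OF assms]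
      lborel.nn_integral_fst[OF nn_integral_polar_pair(2)[OF assms], symmetric]
    by (intro nn_integral_cong) (auto simp: indicator_def)
  also have "\<dots> = (\<integral>\<^sup>+r. ennreal r * indicator {0<..} r *
      (\<integral>\<^sup>+t\<in>{0..<2 * pi}. g (rcis r t) \<partial>lborel) \<partial>lborel)"
    by (intro nn_integral_cong nn_integral_cmult) measurable
  finally show ?thesis by (simp add: mult_ac)
qed

section \<open>Circular arcs\<close>

text \<open>An arc is a compact set, the image of \<open>{a..b}\<close>, with at most the images of
  the two endpoints removed.\<close>

lemma sets_circle_arc:
  assumes "I \<in> circle_arcs" shows "I \<in> sets borel"
proof -
  from assms obtain S a b where I: "I = cis ` S" "{a<..<b} \<subseteq> S" "S \<subseteq> {a..b}"
    by (auto simp: circle_arcs_def)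
  have "compact (cis ` {a..b})"
    by (intro compact_continuous_image continuous_intros) auto
  then have "cis ` {a..b} \<in> sets borel"
    by (intro borel_closed compact_imp_closed)
  moreover have "I = cis ` {a..b} - (cis ` {a..b} - I)"
    using I by auto
  moreover have "{a..b} \<subseteq> S \<union> {a, b}"
    using I(2) by (force simp: less_le)
  then have "cis ` {a..b} - I \<subseteq> cis ` {a, b}"
    unfolding I(1) by blast
  then have "finite (cis ` {a..b} - I)"
    by (rule finite_subset) auto
  ultimately show ?thesis
    by (metis sets.Diff finite_imp_closed borel_closed)
qed

lemma cis_measurable_circle: "cis \<in> borel_measurable (restrict_space lborel {0..<2 * pi})"
  by (intro measurable_restrict_space1) (simp add: borel_measurable_continuous_onI continuous_intros)

lemma emeasure_circle_measure:
  assumes [measurable]: "I \<in> sets borel"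
  shows "emeasure circle_measure I = (\<integral>\<^sup>+t\<in>{0..<2 * pi}. indicator I (cis t) \<partial>lborel)"
proof -
  have [measurable]: "cis \<in> borel_measurable borel"
    by (intro borel_measurable_continuous_onI continuous_intros)
  have "(\<integral>\<^sup>+t\<in>{0..<2 * pi}. indicator I (cis t) \<partial>lborel) = (\<integral>\<^sup>+t. indicator (cis -` I \<inter> {0..<2 * pi}) t \<partial>lborel)"
    by (intro nn_integral_cong) (auto simp: indicator_def)
  also have "\<dots> = emeasure lborel (cis -` I \<inter> {0..<2 * pi})"
    using measurable_sets_borel[of cis borel I] by (intro nn_integral_indicator) auto
  also have "\<dots> = emeasure circle_measure I"
    unfolding circle_measure_def
    by (subst emeasure_distr[OF cis_measurable_circle])
       (auto simp: emeasure_restrict_space space_restrict_space)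
  finally show ?thesis by simp
qed

text \<open>After a shift by a multiple of \<open>2 * pi\<close> the left endpoint lies in
  \<open>[0, 2 * pi)\<close>. The arc then unrolls in \<open>[0, 2 * pi)\<close> to at most two
  intervals, up to finitely many endpoints.\<close>

lemma emeasure_circle_arc:
  assumes ab: "a < b" "b \<le> a + 2 * pi" and S: "{a<..<b} \<subseteq> S" "S \<subseteq> {a..b}"
  shows "emeasure circle_measure (cis ` S) = ennreal (b - a)"
proof -
  define k where "k = \<lfloor>a / (2 * pi)\<rfloor>"
  define a' b' where "a' = a - 2 * pi * of_int k" and "b' = b - 2 * pi * of_int k"
  have k: "of_int k * (2 * pi) \<le> a" "a < (of_int k + 1) * (2 * pi)"
    using floor_divide_lower[of "2 * pi" a] floor_divide_upper[of "2 * pi" a] by (auto simp: k_def)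
  have a': "0 \<le> a'" "a' < 2 * pi" "a' < b'" "b' \<le> a' + 2 * pi"
    using k ab by (auto simp: a'_def b'_def algebra_simps)
  have I: "cis ` S \<in> sets borel"
    using assms by (intro sets_circle_arc) (auto simp: circle_arcs_def)
  define T where "T = cis -` (cis ` S) \<inter> {0..<2 * pi}"
  \<comment> \<open>Only the shifted interval and its translate by \<open>- 2 * pi\<close> can meet
    \<open>[0, 2 * pi)\<close> in an interval, since \<open>0 \<le> a'\<close> and
    \<open>b' < 4 * pi\<close>.\<close>
  define X where "X = ({a'<..<b'} \<union> {a' - 2 * pi<..<b' - 2 * pi}) \<inter> {0..<2 * pi}"
  have XT: "X \<subseteq> T"
  proof
    fix t assume t: "t \<in> X"
    then consider "t \<in> {a'<..<b'}" | "t \<in> {a' - 2 * pi<..<b' - 2 * pi}" by (auto simp: X_def)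
    then obtain n :: int where "t + 2 * pi * of_int n \<in> {a<..<b}"
    proof cases
      case 1 then show ?thesis by (intro that[of k]) (auto simp: a'_def b'_def)
    next
      case 2 then show ?thesis by (intro that[of "k + 1"]) (auto simp: a'_def b'_def algebra_simps)
    qed
    with S have "cis (t + 2 * pi * of_int n) \<in> cis ` S" by auto
    also have "cis (t + 2 * pi * of_int n) = cis t" by (auto simp: cis_eq_cis_iff)
    finally show "t \<in> T" using t by (auto simp: T_def X_def)
  qed
  have TX: "T \<subseteq> X \<union> {a', b', a' - 2 * pi, b' - 2 * pi}"
  proof
    fix t assume t: "t \<in> T"
    then obtain s where s: "s \<in> S" "cis t = cis s" by (auto simp: T_def)
    then obtain n where n: "t = s + 2 * pi * of_int n" by (auto simp: cis_eq_cis_iff)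
    define m where "m = n + k"
    define s' where "s' = s - 2 * pi * of_int k"
    have ts: "t = s' + 2 * pi * of_int m" by (simp add: n m_def s'_def algebra_simps)
    have s': "a' \<le> s'" "s' \<le> b'" using s S by (auto simp: s'_def a'_def b'_def)
    have t': "0 \<le> t" "t < 2 * pi" using t by (auto simp: T_def)
    \<comment> \<open>Here \<open>t\<close> lies in \<open>[0, 2 * pi)\<close> and \<open>s'\<close>
      in \<open>[0, 4 * pi)\<close>, which leaves only the two translates in
      \<open>X\<close>.\<close>
    have "2 * pi * of_int m < 2 * pi * 1" "2 * pi * (-2) < 2 * pi * of_int m"
      using ts s' a' t' by linarith+
    then have "m = 0 \<or> m = -1"
      unfolding mult_less_cancel_left_pos[OF pi_gt_zero[THEN mult_pos_pos[OF zero_less_numeral]]] by auto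
    then show "t \<in> X \<union> {a', b', a' - 2 * pi, b' - 2 * pi}"
      using ts s' t by (auto simp: X_def T_def)
  qed
  have "emeasure circle_measure (cis ` S) = emeasure lborel T"
    unfolding circle_measure_def
    by (subst emeasure_distr[OF cis_measurable_circle])
       (auto simp: emeasure_restrict_space space_restrict_space I T_def)
  also have "T = X \<union> (T - X)" using XT by auto
  also have "emeasure lborel \<dots> = emeasure lborel X"
  proof (rule emeasure_Un_null_set)
    have "T - X \<subseteq> {a', b', a' - 2 * pi, b' - 2 * pi}" using TX by auto
    then have "finite (T - X)" by (rule finite_subset) auto
    then show "T - X \<in> null_sets lborel" by (intro finite_imp_null_set_lborel)
  qed (simp add: X_def)
  also have "emeasure lborel X = ennreal (b' - a')"
  proof (cases "b' \<le> 2 * pi")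
    case True
    then have "X = {a'<..<b'}" using a' by (auto simp: X_def)
    then show ?thesis using a' by simp
  next
    case False
    \<comment> \<open>The arc passes through 1 and splits in two; the pieces are disjoint because
      \<open>b' - 2 * pi \<le> a'\<close>.\<close>
    then have "X = {a'<..<2 * pi} \<union> {0..<b' - 2 * pi}" using a' by (auto simp: X_def)
    moreover have "emeasure lborel ({a'<..<2 * pi} \<union> {0..<b' - 2 * pi})
        = emeasure lborel {a'<..<2 * pi} + emeasure lborel {0..<b' - 2 * pi}"
      using a' by (intro plus_emeasure[symmetric]) auto
    ultimately show ?thesis using a' False by (simp flip: ennreal_plus)
  qed
  finally show ?thesis by (simp add: a'_def b'_def)
qed

lemma measure_circle_arc:
  assumes "a < b" "b \<le> a + 2 * pi" "{a<..<b} \<subseteq> S" "S \<subseteq> {a..b}"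
  shows "measure circle_measure (cis ` S) = b - a"
  using emeasure_circle_arc[OF assms] assms(1) by (simp add: measure_def)

lemma emeasure_arc_measure:
  assumes "I \<in> circle_arcs"
  shows "emeasure circle_measure I = ennreal (measure circle_measure I)" "0 < measure circle_measure I"
proof -
  obtain S a b where S: "I = cis ` S" "a < b" "b \<le> a + 2 * pi" "{a<..<b} \<subseteq> S" "S \<subseteq> {a..b}"
    using assms by (auto simp: circle_arcs_def)
  then show "emeasure circle_measure I = ennreal (measure circle_measure I)" "0 < measure circle_measure I"
    using measure_circle_arc[OF S(2-5)] emeasure_circle_arc[OF S(2-5)] by simp_all
qed

section \<open>Carleson squares\<close>

lemma emeasure_unit_disc: "emeasure lborel unit_disc = ennreal pi"
  by (simp add: emeasure_ball unit_ball_vol_2)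

lemma sets_disc_area: "sets disc_area = sets (lebesgue_on unit_disc)"
  by (simp add: disc_area_def)

text \<open>Measurability is asked on the disc only, because \<open>f\<close> is arbitrary outside
  it. Completing a measure does not change nonnegative integrals, so \<open>lborel\<close> can
  replace Lebesgue measure.\<close>

lemma nn_integral_disc_area:
  assumes "w \<in> borel_measurable (lebesgue_on unit_disc)"
  shows "(\<integral>\<^sup>+z. w z \<partial>disc_area) = (\<integral>\<^sup>+z\<in>unit_disc. w z \<partial>lborel) / ennreal pi"
proof -
  have "emeasure (lebesgue_on unit_disc) unit_disc = ennreal pi"
    by (subst emeasure_restrict_space) (auto simp: emeasure_unit_disc)
  then have "(\<integral>\<^sup>+z. w z \<partial>disc_area) =
      (\<integral>\<^sup>+z\<in>unit_disc. w z \<partial>lebesgue_on unit_disc) / ennreal pi"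
    unfolding disc_area_def using assms
    by (subst nn_integral_uniform_measure) auto
  also have "(\<integral>\<^sup>+z\<in>unit_disc. w z \<partial>lebesgue_on unit_disc) = (\<integral>\<^sup>+z\<in>unit_disc. w z \<partial>lborel)"
    by (subst nn_integral_restrict_space)
       (auto simp: nn_integral_completion mult.assoc intro!: nn_integral_cong split: split_indicator)
  finally show ?thesis .
qed

lemma borel_measurable_disc_area_borel:
  "w \<in> borel_measurable borel \<Longrightarrow> w \<in> borel_measurable (lebesgue_on unit_disc)"
  by (intro measurable_restrict_space1 measurable_completion) simp

lemma nn_integral_disc_area_subset:
  assumes "w \<in> borel_measurable (lebesgue_on unit_disc)" "Q \<in> sets borel" "Q \<subseteq> unit_disc"
  shows "(\<integral>\<^sup>+z\<in>Q. w z \<partial>disc_area) = (\<integral>\<^sup>+z\<in>Q. w z \<partial>lborel) / ennreal pi"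
proof -
  have "(\<lambda>z. w z * indicator Q z) \<in> borel_measurable (lebesgue_on unit_disc)"
    by (intro borel_measurable_times_ennreal assms(1) borel_measurable_disc_area_borel) (use assms in auto)
  then show ?thesis
    using assms(3)
    by (subst nn_integral_disc_area)
       (auto intro!: arg_cong[where f = "\<lambda>x. x / _"] nn_integral_cong split: split_indicator)
qed

lemma emeasure_disc_area:
  assumes "Q \<in> sets borel" "Q \<subseteq> unit_disc"
  shows "emeasure disc_area Q = emeasure lborel Q / ennreal pi"
proof -
  have "Q \<in> sets disc_area"
    using assms by (auto simp: sets_disc_area sets_restrict_space_iff)
  then have "emeasure disc_area Q = (\<integral>\<^sup>+z\<in>Q. 1 \<partial>disc_area)"
    by simp
  also have "\<dots> = emeasure lborel Q / ennreal pi"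
    using assms by (subst nn_integral_disc_area_subset) auto
  finally show ?thesis .
qed

lemma emeasure_disc_area_finite:
  assumes "Q \<in> sets borel" "Q \<subseteq> unit_disc"
  shows "emeasure disc_area Q < top"
proof -
  have "emeasure lborel Q \<le> emeasure lborel unit_disc"
    using assms by (intro emeasure_mono) auto
  then show ?thesis
    unfolding emeasure_disc_area[OF assms] emeasure_unit_disc
    by (auto simp: ennreal_divide_eq_top_iff top_unique less_top[symmetric])
qed

section \<open>Measurability, radial integrals and area of Carleson squares\<close>

lemma carleson_square_subset: "carleson_square I \<subseteq> unit_disc"
  by (auto simp: carleson_square_def)

lemma rcis_in_carleson_square:
  "0 < r \<Longrightarrow> rcis r t \<in> carleson_square I \<longleftrightarrow> cis t \<in> I \<and> r < 1 \<and> 1 - r < measure circle_measure I"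
  by (auto simp: carleson_square_def rcis_def norm_mult)

lemma sets_carleson_square:
  assumes "I \<in> sets borel"
  shows "carleson_square I \<in> sets borel"
proof -
  have "(\<lambda>z::complex. z / of_real (cmod z)) \<in> borel_measurable borel"
    by measurable
  from measurable_sets_borel[OF this assms]
  have "(\<lambda>z::complex. z / of_real (cmod z)) -` I \<in> sets borel" .
  moreover have "{z::complex. 1 - cmod z < measure circle_measure I} \<in> sets borel"
    by measurable
  moreover have "carleson_square I = (unit_disc - {0}) \<inter> (\<lambda>z. z / of_real (cmod z)) -` I \<inter>
      {z. 1 - cmod z < measure circle_measure I}"
    by (auto simp: carleson_square_def)
  ultimately show ?thesis by auto
qed

text \<open>A Carleson square is a product in polar coordinates, so the integral of a radial
  function splits. The \<open>max 0\<close> covers arcs of length above 1, whose squares reach down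
  to the origin.\<close>

lemma nn_integral_radial_carleson_square:
  fixes h :: "real \<Rightarrow> ennreal"
  assumes I[measurable]: "I \<in> sets borel" and [measurable]: "h \<in> borel_measurable borel"
  shows "(\<integral>\<^sup>+z\<in>carleson_square I. h (cmod z) \<partial>lborel) = emeasure circle_measure I *
     (\<integral>\<^sup>+r\<in>{max 0 (1 - measure circle_measure I)<..<1}. ennreal r * h r \<partial>lborel)"
    (is "_ = _ * ?J")
proof -
  have [measurable]: "carleson_square I \<in> sets borel" by (rule sets_carleson_square) fact
  have [measurable]: "cis \<in> borel_measurable borel"
    by (intro borel_measurable_continuous_onI continuous_intros)
  have "(\<integral>\<^sup>+z\<in>carleson_square I. h (cmod z) \<partial>lborel) = (\<integral>\<^sup>+t\<in>{0..<2 * pi}. (\<integral>\<^sup>+r\<in>{0<..}.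
      ennreal r * (h (cmod (rcis r t)) * indicator (carleson_square I) (rcis r t)) \<partial>lborel) \<partial>lborel)"
    by (rule nn_integral_polar) measurable
  also have "\<dots> = (\<integral>\<^sup>+t. (indicator I (cis t) * indicator {0..<2 * pi} t) * ?J \<partial>lborel)"
  proof (intro nn_integral_cong)
    fix t :: real
    have "(\<integral>\<^sup>+r\<in>{0<..}. ennreal r * (h (cmod (rcis r t)) * indicator (carleson_square I) (rcis r t)) \<partial>lborel)
      = (\<integral>\<^sup>+r. indicator I (cis t) * (ennreal r * h r *
           indicator {max 0 (1 - measure circle_measure I)<..<1} r) \<partial>lborel)"
      by (intro nn_integral_cong) (auto simp: rcis_in_carleson_square indicator_def)
    also have "\<dots> = indicator I (cis t) * ?J"
      by (rule nn_integral_cmult) measurable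
    finally show "(\<integral>\<^sup>+r\<in>{0<..}. ennreal r * (h (cmod (rcis r t)) * indicator (carleson_square I) (rcis r t)) \<partial>lborel)
      * indicator {0..<2 * pi} t = (indicator I (cis t) * indicator {0..<2 * pi} t) * ?J"
      by (simp add: mult_ac)
  qed
  also have "\<dots> = (\<integral>\<^sup>+t\<in>{0..<2 * pi}. indicator I (cis t) \<partial>lborel) * ?J"
    by (rule nn_integral_multc) measurable
  finally show ?thesis by (simp add: emeasure_circle_measure)
qed

lemma nn_integral_Ioo_has_integral:
  fixes f :: "real \<Rightarrow> real"
  assumes "(f has_integral J) {a..b}" "f \<in> borel_measurable borel"
    and "\<And>x. a < x \<Longrightarrow> x < b \<Longrightarrow> 0 \<le> f x"
  shows "(\<integral>\<^sup>+x\<in>{a<..<b}. ennreal (f x) \<partial>lborel) = ennreal J"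
proof -
  have "(f has_integral J) {a<..<b}"
    using assms(1) by (simp add: has_integral_Icc_iff_Ioo)
  then have "((\<lambda>x. if x \<in> {a<..<b} then f x else 0) has_integral J) UNIV"
    by (simp only: has_integral_restrict_UNIV)
  then have "(\<integral>\<^sup>+x. ennreal (if x \<in> {a<..<b} then f x else 0) \<partial>lborel) = ennreal J"
    using assms by (intro nn_integral_has_integral_lborel) auto
  also have "(\<lambda>x. ennreal (if x \<in> {a<..<b} then f x else 0)) = (\<lambda>x. ennreal (f x) * indicator {a<..<b} x)"
    by (auto simp: fun_eq_iff)
  finally show ?thesis .
qed

text \<open>Only the primitive has to be continuous up to the endpoints, so that integrands such as
  \<open>1 / sqrt (1 - r)\<close>, unbounded near 1, are covered.\<close>

lemma nn_integral_Ioo_FTC: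
  fixes F f :: "real \<Rightarrow> real"
  assumes "a \<le> b" "continuous_on {a..b} F" "f \<in> borel_measurable borel"
    and "\<And>x. a < x \<Longrightarrow> x < b \<Longrightarrow> (F has_real_derivative f x) (at x)"
    and "\<And>x. a < x \<Longrightarrow> x < b \<Longrightarrow> 0 \<le> f x"
  shows "(\<integral>\<^sup>+x\<in>{a<..<b}. ennreal (f x) \<partial>lborel) = ennreal (F b - F a)"
  using assms
  by (intro nn_integral_Ioo_has_integral fundamental_theorem_of_calculus_interior)
     (auto simp: has_real_derivative_iff_has_vector_derivative)

lemma emeasure_carleson_square:
  assumes I: "I \<in> sets borel" and l: "emeasure circle_measure I = ennreal l" "0 \<le> l"
  shows "emeasure disc_area (carleson_square I) = ennreal (l * (1 - (max 0 (1 - l))\<^sup>2) / (2 * pi))"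
proof -
  have ml: "measure circle_measure I = l" using l by (simp add: measure_def)
  have "(\<integral>\<^sup>+r\<in>{max 0 (1 - l)<..<1}. ennreal r * 1 \<partial>lborel) = ennreal (1\<^sup>2 / 2 - (max 0 (1 - l))\<^sup>2 / 2)"
    unfolding mult_1_right
    by (rule nn_integral_Ioo_FTC) (use l(2) in \<open>auto intro!: continuous_intros derivative_eq_intros\<close>)
  then have "emeasure lborel (carleson_square I) = ennreal l * ennreal (1\<^sup>2 / 2 - (max 0 (1 - l))\<^sup>2 / 2)"
    using nn_integral_radial_carleson_square[OF I, of "\<lambda>_. 1"] sets_carleson_square[OF I] l ml by simp
  also have "\<dots> = ennreal (l * (1 - (max 0 (1 - l))\<^sup>2) / 2)"
    using l by (subst ennreal_mult'[symmetric]) (auto simp: field_simps)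
  finally have "emeasure lborel (carleson_square I) = ennreal (l * (1 - (max 0 (1 - l))\<^sup>2) / 2)" .
  moreover have "(max 0 (1 - l))\<^sup>2 \<le> 1" using l(2) by (intro power_le_one) auto
  ultimately show ?thesis
    using l by (subst emeasure_disc_area[OF sets_carleson_square[OF I] carleson_square_subset])
      (simp add: divide_ennreal)
qed

lemma emeasure_carleson_square_pos:
  assumes "I \<in> sets borel" "emeasure circle_measure I = ennreal l" "0 < l"
  shows "0 < emeasure disc_area (carleson_square I)"
proof -
  have "(max 0 (1 - l))\<^sup>2 < 1"
    using \<open>0 < l\<close> by (subst abs_square_less_1) auto
  then show ?thesis
    using assms(3) by (subst emeasure_carleson_square[OF assms(1,2)]) auto
qed

section \<open>Arc length against area\<close>

lemma measure_carleson_square: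
  assumes I: "I \<in> circle_arcs"
  defines "l \<equiv> measure circle_measure I"
  shows "measure disc_area (carleson_square I) = l * (1 - (max 0 (1 - l))\<^sup>2) / (2 * pi)"
proof -
  have "0 < l" using emeasure_arc_measure(2)[OF I] by (simp add: l_def)
  moreover have "(max 0 (1 - l))\<^sup>2 \<le> 1" using \<open>0 < l\<close> by (intro power_le_one) auto
  ultimately show ?thesis
    using emeasure_carleson_square[OF sets_circle_arc[OF I] emeasure_arc_measure(1)[OF I]]
    by (simp add: measure_def l_def)
qed

text \<open>The limit in (ii) runs over areas and the estimates run over arc lengths. This lemma and
  the next one translate between the two; here the factor \<open>1 / (2 * pi)\<close> is below
  1.\<close>

lemma measure_carleson_square_less:
  assumes "I \<in> circle_arcs"
  shows "measure disc_area (carleson_square I) < measure circle_measure I"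
proof -
  let ?l = "measure circle_measure I"
  have "0 < ?l" by (rule emeasure_arc_measure(2)[OF assms])
  moreover have "?l * (1 - (max 0 (1 - ?l))\<^sup>2) \<le> ?l * 1"
    using \<open>0 < ?l\<close> by (intro mult_left_mono) auto
  moreover have "?l * 1 < ?l * (2 * pi)"
    using \<open>0 < ?l\<close> pi_gt3 by (intro mult_strict_left_mono) auto
  ultimately show ?thesis
    unfolding measure_carleson_square[OF assms]
    by (subst pos_divide_less_eq, simp, linarith)
qed

text \<open>An arc of length at least \<open>x\<close> has a square of area at least
  \<open>x\<^sup>2 / (2 * pi)\<close>, because \<open>(1 - x)\<^sup>2 \<le> 1 - x\<close> on
  \<open>[0, 1]\<close>.\<close>

lemma measure_circle_less_of_carleson_square:
  assumes I: "I \<in> circle_arcs" and x: "0 < x" "x \<le> 1"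
    and A: "measure disc_area (carleson_square I) < x\<^sup>2 / (2 * pi)"
  shows "measure circle_measure I < x"
proof (rule ccontr)
  let ?l = "measure circle_measure I"
  assume "\<not> ?l < x"
  then have l: "x \<le> ?l" by simp
  have "(max 0 (1 - ?l))\<^sup>2 \<le> (1 - x)\<^sup>2"
    using l x by (intro power_mono) auto
  also have "\<dots> \<le> 1 - x"
    using x by (simp add: power2_eq_square mult_left_le)
  finally have "x * x \<le> ?l * (1 - (max 0 (1 - ?l))\<^sup>2)"
    using l x by (intro mult_mono) auto
  then have "x\<^sup>2 / (2 * pi) \<le> measure disc_area (carleson_square I)"
    unfolding measure_carleson_square[OF I] by (intro divide_right_mono) (auto simp: power2_eq_square)
  with A show False by simp
qed

text \<open>Keeps the supremum in (ii) from being taken over the empty set, where it would be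
  0.\<close>

lemma exists_small_carleson_square:
  assumes "0 < d"
  obtains I where "I \<in> circle_arcs" "measure disc_area (carleson_square I) < d"
proof -
  define l where "l = min 1 d"
  have l: "0 < l" "l \<le> 2 * pi" "l \<le> d" using assms pi_gt3 by (auto simp: l_def min_def)
  have "cis ` {0..l} \<in> circle_arcs"
    unfolding circle_arcs_def using l
    by (intro CollectI exI[of _ "{0..l}"] exI[of _ 0] exI[of _ l])
       (auto simp: greaterThanLessThan_subseteq_atLeastAtMost_iff)
  moreover have "measure circle_measure (cis ` {0..l}) = l"
    using measure_circle_arc[of 0 l "{0..l}"] l by (simp add: greaterThanLessThan_subseteq_atLeastAtMost_iff)
  ultimately show ?thesis
    using that measure_carleson_square_less l(3) by fastforce
qed

section \<open>A disc of comparable size inside a Carleson square\<close>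

lemma abs_Arg_le:
  assumes "0 < Re u" shows "\<bar>Arg u\<bar> \<le> \<bar>Im u\<bar> / Re u"
proof -
  have "Arg u = arctan (Im u / Re u)"
    using arg_conv_arctan[OF assms] by simp
  also have "\<bar>\<dots>\<bar> \<le> \<bar>Im u / Re u\<bar>"
  proof -
    have le: "arctan x \<le> x" if "0 \<le> x" for x :: real
    proof -
      have "0 - arctan 0 \<le> x - arctan x"
        by (rule DERIV_nonneg_imp_nondecreasing[OF that, of "\<lambda>x. x - arctan x"])
           (auto intro!: derivative_eq_intros exI simp: add_pos_nonneg field_simps)
      then show ?thesis by simp
    qed
    have "\<bar>arctan x\<bar> \<le> \<bar>x\<bar>" for x :: real
      using le[of x] le[of "- x"] by (cases "0 \<le> x") (auto simp: arctan_minus)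
    then show ?thesis .
  qed
  finally show ?thesis using assms by (simp add: abs_divide)
qed

text \<open>The arc is centred at the direction of \<open>z\<close>. The point lies at depth
  \<open>l / 4\<close> below the unit circle, well inside a square of depth \<open>l\<close>, so a
  disc of radius proportional to \<open>l\<close> fits. The bound \<open>3 / 4\<close> on
  \<open>cmod z\<close> makes \<open>l \<le> 1\<close>.\<close>

lemma carleson_square_near_point:
  assumes z: "cmod z < 1" "3 / 4 \<le> cmod z"
  defines "l \<equiv> 4 * (1 - cmod z)"
  obtains I where "I \<in> circle_arcs" "measure circle_measure I = l" "ball z (l / 8) \<subseteq> carleson_square I"
proof -
  define \<phi> where "\<phi> = Arg z"
  define S where "S = {\<phi> - l / 2..\<phi> + l / 2}"
  have leq: "l = 4 * (1 - cmod z)" by (simp add: l_def)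
  have l: "0 < l" "l \<le> 1" using z by (auto simp: l_def)
  have S: "\<phi> - l / 2 < \<phi> + l / 2" "\<phi> + l / 2 \<le> \<phi> - l / 2 + 2 * pi"
    "{\<phi> - l / 2<..<\<phi> + l / 2} \<subseteq> S" "S \<subseteq> {\<phi> - l / 2..\<phi> + l / 2}"
    using l pi_gt3 by (auto simp: S_def)
  have arc: "cis ` S \<in> circle_arcs"
    unfolding circle_arcs_def using S by blast
  have ml: "measure circle_measure (cis ` S) = l"
    using measure_circle_arc[OF S] by simp
  have z0: "z \<noteq> 0" using z by auto
  have "w \<in> carleson_square (cis ` S)" if w: "w \<in> ball z (l / 8)" for w
  proof -
    \<comment> \<open>The angle from \<open>z\<close> to \<open>w\<close> is \<open>Arg u\<close>,
      and it is small because \<open>u\<close> is close to 1.\<close>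
    define u where "u = w / z"
    define d where "d = cmod (u - 1)"
    have "u - 1 = (w - z) / z"
      using z0 by (simp add: u_def diff_divide_distrib)
    then have "d = cmod (w - z) / cmod z"
      by (simp add: d_def norm_divide)
    also have "\<dots> < (l / 8) / cmod z"
      using w z0 by (intro divide_strict_right_mono) (auto simp: dist_norm norm_minus_commute)
    also have "\<dots> \<le> (l / 8) / (3 / 4)"
      using z l by (intro divide_left_mono) auto
    finally have d: "d < l / 6" by simp
    have "\<bar>Re u - 1\<bar> \<le> d" "\<bar>Im u\<bar> \<le> d"
      using abs_Re_le_cmod[of "u - 1"] abs_Im_le_cmod[of "u - 1"] by (auto simp: d_def)
    then have Re: "5 / 6 \<le> Re u" and Im: "\<bar>Im u\<bar> \<le> l / 6" using d l by linarith+
    have "\<bar>Arg u\<bar> \<le> \<bar>Im u\<bar> / Re u" using Re by (intro abs_Arg_le) auto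
    \<comment> \<open>The bound \<open>5 / 6\<close> is \<open>1 - l / 6\<close> at the worst case
      \<open>l = 1\<close>. The quotient is \<open>l / 5\<close>, within the half-length
      \<open>l / 2\<close> of the arc.\<close>
    also have "\<dots> \<le> (l / 6) / (5 / 6)" using Re Im l by (intro frac_le) auto
    also have "\<dots> \<le> l / 2" using l by simp
    finally have "\<phi> + Arg u \<in> S" by (auto simp: S_def abs_le_iff)
    moreover have w0: "w \<noteq> 0" using Re z0 by (auto simp: u_def)
    have "w / cmod w = cis (\<phi> + Arg u)"
    proof -
      have "w = z * u" using z0 by (simp add: u_def)
      also have "\<dots> = rcis (cmod z) \<phi> * rcis (cmod u) (Arg u)"
        by (simp add: \<phi>_def rcis_cmod_Arg)
      also have "\<dots> = rcis (cmod w) (\<phi> + Arg u)"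
        using z0 by (simp add: rcis_mult u_def norm_divide)
      finally have "w = rcis (cmod w) (\<phi> + Arg u)" .
      then show ?thesis using w0 by (metis nonzero_mult_div_cancel_left norm_eq_zero of_real_eq_0_iff rcis_def)
    qed
    \<comment> \<open>As \<open>cmod z = 1 - l / 4\<close>, a radial change below
      \<open>l / 8\<close> keeps \<open>1 - cmod w\<close> strictly between \<open>l / 8\<close> and
      \<open>3 * l / 8\<close>.\<close>
    moreover have "\<bar>cmod w - cmod z\<bar> < l / 8"
      using w norm_triangle_ineq3[of w z] by (simp add: dist_norm norm_minus_commute)
    then have "cmod w - cmod z < l / 8" "- (l / 8) < cmod w - cmod z"
      unfolding abs_less_iff by auto
    then have "8 * cmod w < 4 + 4 * cmod z" "12 * cmod z < 4 + 8 * cmod w"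
      using leq by (simp_all add: field_simps)
    then have "1 - cmod w < l" "cmod w < 1" using z(1) leq by argo+
    ultimately show ?thesis using w0 ml by (auto simp: carleson_square_def)
  qed
  then show ?thesis using that[OF arc ml] by blast
qed

section \<open>Averages\<close>

lemma area_average_mono:
  assumes "\<And>z. z \<in> Q \<Longrightarrow> w z \<le> v z"
  shows "area_average Q w \<le> area_average Q v"
  unfolding area_average_def using assms
  by (intro divide_right_mono_ennreal nn_integral_mono) (auto intro!: ennreal_leI split: split_indicator)

text \<open>The signs matter: \<open>ennreal\<close> truncates negative values to 0, so additivity
  would fail without them.\<close>

lemma area_average_linear:
  assumes Q: "Q \<in> sets borel" "Q \<subseteq> unit_disc"
    and v: "v \<in> borel_measurable (lebesgue_on unit_disc)" "\<And>z. z \<in> Q \<Longrightarrow> 0 \<le> v z"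
    and w: "w \<in> borel_measurable (lebesgue_on unit_disc)" "\<And>z. z \<in> Q \<Longrightarrow> 0 \<le> w z"
    and ab: "0 \<le> a" "0 \<le> b"
  shows "area_average Q (\<lambda>z. a * v z + b * w z) = ennreal a * area_average Q v + ennreal b * area_average Q w"
proof -
  have sets: "Q \<in> sets disc_area"
    using Q by (auto simp: sets_disc_area sets_restrict_space_iff)
  have [measurable]: "v \<in> borel_measurable disc_area" "w \<in> borel_measurable disc_area"
    using v(1) w(1) measurable_cong_sets[OF sets_disc_area refl] by blast+
  have [measurable]: "indicator Q \<in> borel_measurable disc_area" using sets by simp
  have "(\<integral>\<^sup>+z\<in>Q. ennreal (a * v z + b * w z) \<partial>disc_area)
      = (\<integral>\<^sup>+z. ennreal a * (ennreal (v z) * indicator Q z) + ennreal b * (ennreal (w z) * indicator Q z) \<partial>disc_area)"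
  proof (rule nn_integral_cong)
    fix z
    have "ennreal (a * v z + b * w z) = ennreal a * ennreal (v z) + ennreal b * ennreal (w z)" if "z \<in> Q"
      using v(2)[OF that] w(2)[OF that] ab
      by (subst ennreal_plus, simp, simp, subst ennreal_mult, simp, simp, subst ennreal_mult) auto
    then show "ennreal (a * v z + b * w z) * indicator Q z
        = ennreal a * (ennreal (v z) * indicator Q z) + ennreal b * (ennreal (w z) * indicator Q z)"
      by (cases "z \<in> Q") auto
  qed
  also have "\<dots> = ennreal a * (\<integral>\<^sup>+z\<in>Q. ennreal (v z) \<partial>disc_area) + ennreal b * (\<integral>\<^sup>+z\<in>Q. ennreal (w z) \<partial>disc_area)"
    by (subst nn_integral_add) (auto simp: nn_integral_cmult)
  finally show ?thesis
    unfolding area_average_def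
    by (simp only: add_divide_distrib_ennreal ennreal_times_divide)
qed

lemma area_average_one:
  assumes Q: "Q \<in> sets borel" "Q \<subseteq> unit_disc" "0 < emeasure disc_area Q"
  shows "area_average Q (\<lambda>_. 1) = 1"
proof -
  have "Q \<in> sets disc_area"
    using Q by (auto simp: sets_disc_area sets_restrict_space_iff)
  then show ?thesis
    unfolding area_average_def
    using Q(3) emeasure_disc_area_finite[OF Q(1,2)] by simp
qed

text \<open>Since \<open>0 * top = 0\<close>, a finite product of averages has finite factors only
  once neither factor vanishes.\<close>

lemma area_average_pos:
  assumes Q: "Q \<in> sets borel" "Q \<subseteq> unit_disc" "0 < emeasure disc_area Q"
    and w: "w \<in> borel_measurable (lebesgue_on unit_disc)" "\<And>z. z \<in> Q \<Longrightarrow> 0 < w z"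
  shows "0 < area_average Q w"
proof -
  have sets: "Q \<in> sets disc_area"
    using Q by (auto simp: sets_disc_area sets_restrict_space_iff)
  have [measurable]: "w \<in> borel_measurable disc_area"
    using w(1) measurable_cong_sets[OF sets_disc_area refl] by blast
  have [measurable]: "indicator Q \<in> borel_measurable disc_area" using sets by simp
  have "(\<integral>\<^sup>+z\<in>Q. ennreal (w z) \<partial>disc_area) \<noteq> 0"
  proof
    assume "(\<integral>\<^sup>+z\<in>Q. ennreal (w z) \<partial>disc_area) = 0"
    then have "AE z in disc_area. ennreal (w z) * indicator Q z = 0"
      by (subst (asm) nn_integral_0_iff_AE) auto
    then have "AE z in disc_area. z \<notin> Q"
      by eventually_elim (use w(2) in \<open>force split: split_indicator_asm\<close>)
    then have "emeasure disc_area Q = 0"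
      using AE_iff_null_sets[OF sets] by (simp add: null_sets_def)
    with Q(3) show False by simp
  qed
  then show ?thesis
    unfolding area_average_def using emeasure_disc_area_finite[OF Q(1,2)]
    by (simp add: zero_less_iff_neq_zero ennreal_divide_eq_0_iff less_top[symmetric])
qed

text \<open>The singularity \<open>(1 - r) powr (- 1 / 2)\<close> is integrable, and the bound does
  not depend on the arc: with \<open>m = min 1 l\<close> the radial integral is at most
  \<open>2 * m\<close>, the area is \<open>l * m * (2 - m) / (2 * pi)\<close>, and the quotient
  \<open>4 / (2 - m)\<close> is at most 4.\<close>

lemma area_average_sqrt_carleson_square:
  assumes I: "I \<in> sets borel" and l: "emeasure circle_measure I = ennreal l" "0 < l"
  shows "area_average (carleson_square I) (\<lambda>z. sqrt (min 1 l / (1 - cmod z))) \<le> 4"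
proof -
  define m where "m = min 1 l"
  have m: "0 < m" "m \<le> 1" "m \<le> l" "max 0 (1 - l) = 1 - m" using l by (auto simp: m_def)
  have ml: "measure circle_measure I = l" using l by (simp add: measure_def)
  have "(\<integral>\<^sup>+r\<in>{1 - m<..<1}. ennreal r * ennreal (sqrt (m / (1 - r))) \<partial>lborel)
      \<le> (\<integral>\<^sup>+r\<in>{1 - m<..<1}. ennreal (sqrt m / sqrt (1 - r)) \<partial>lborel)"
    using m by (intro nn_integral_mono)
      (auto simp: ennreal_mult'[symmetric] real_sqrt_divide mult_left_le_one_le divide_right_mono
        split: split_indicator intro!: ennreal_leI)
  also have "\<dots> = ennreal (- 2 * sqrt m * sqrt (1 - 1) - (- 2 * sqrt m * sqrt (1 - (1 - m))))"
  proof (rule nn_integral_Ioo_FTC)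
    fix x :: real assume x: "1 - m < x" "x < 1"
    show "((\<lambda>x. - 2 * sqrt m * sqrt (1 - x)) has_real_derivative sqrt m / sqrt (1 - x)) (at x)"
      using x by (auto intro!: derivative_eq_intros simp: field_simps)
  qed (use m in \<open>auto intro!: continuous_intros\<close>)
  also have "\<dots> = ennreal (2 * m)" using m by simp
  finally have "(\<integral>\<^sup>+z\<in>carleson_square I. ennreal (sqrt (m / (1 - cmod z))) \<partial>lborel) \<le> ennreal l * ennreal (2 * m)"
    using nn_integral_radial_carleson_square[OF I, of "\<lambda>r. ennreal (sqrt (m / (1 - r)))"] l ml m
    by (simp add: mult_left_mono)
  moreover have "ennreal l * ennreal (2 * m) = ennreal (l * (2 * m))"
    using l by (subst ennreal_mult') auto
  ultimately have "(\<integral>\<^sup>+z\<in>carleson_square I. ennreal (sqrt (m / (1 - cmod z))) \<partial>disc_area) \<le> ennreal (l * (2 * m)) / ennreal pi"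
    using l by (subst nn_integral_disc_area_subset[OF _ sets_carleson_square[OF I] carleson_square_subset])
     (auto intro!: divide_right_mono_ennreal borel_measurable_disc_area_borel)
  also have "\<dots> = ennreal (l * 2 * m / pi)"
    using l m by (subst divide_ennreal) auto
  also have "\<dots> \<le> ennreal (4 * (l * (1 - (1 - m)\<^sup>2) / (2 * pi)))"
  proof (rule ennreal_leI)
    have "0 \<le> l * m * (1 - m)" using l m by simp
    then have "l * 2 * m / pi \<le> (l * 2 * m + 2 * (l * m * (1 - m))) / pi"
      by (intro divide_right_mono) auto
    also have "\<dots> = 4 * (l * (1 - (1 - m)\<^sup>2) / (2 * pi))"
      by (simp add: power2_eq_square field_simps)
    finally show "l * 2 * m / pi \<le> 4 * (l * (1 - (1 - m)\<^sup>2) / (2 * pi))" .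
  qed
  also have "\<dots> = 4 * emeasure disc_area (carleson_square I)"
    using l by (simp only: emeasure_carleson_square[OF I l(1)] m(4) order_less_imp_le
      ennreal_mult'[of 4, simplified] ennreal_numeral)
  finally show ?thesis
    unfolding area_average_def m_def[symmetric]
    by (intro divide_le_posI_ennreal emeasure_carleson_square_pos[OF I l]) (simp add: mult.commute)
qed

section \<open>Averages of exponentials of Bloch functions\<close>

lemma norm_cis_diff_le: "cmod (cis a - cis b) \<le> \<bar>a - b\<bar>"
proof -
  have "cis a - cis b = cis b * (exp (\<i> * of_real (a - b)) - 1)"
    by (simp add: cis_conv_exp exp_diff algebra_simps)
  then have "cmod (cis a - cis b) = 2 * \<bar>sin ((a - b) / 2)\<bar>"
    by (simp add: norm_mult dist_exp_i_1 del: of_real_diff)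
  also have "\<dots> \<le> \<bar>a - b\<bar>"
    using abs_sin_x_le_abs_x[of "(a - b) / 2"] by simp
  finally show ?thesis .
qed

text \<open>On the radius the derivative is at most \<open>K / (1 - t)\<close>, whose primitive is
  \<open>- K * ln (1 - t)\<close>.\<close>

lemma radial_growth:
  assumes f: "f holomorphic_on unit_disc" and rho: "0 \<le> \<rho>" "\<rho> \<le> r" "r < 1" and w: "cmod w = 1"
    and K: "\<And>t. \<rho> < t \<Longrightarrow> t < r \<Longrightarrow> (1 - t) * cmod (deriv f (of_real t * w)) \<le> K"
  shows "cmod (f (of_real r * w) - f (of_real \<rho> * w)) \<le> K * ln ((1 - \<rho>) / (1 - r))"
proof (cases "\<rho> = r")
  case True
  then show ?thesis using rho by simp
next
  case False
  have in_disc: "of_real t * w \<in> unit_disc" if "\<rho> \<le> t" "t \<le> r" for t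
    using that rho w by (simp add: norm_mult)
  have "cmod (f (of_real r * w) - f (of_real \<rho> * w)) \<le> - K * ln (1 - r) - (- K * ln (1 - \<rho>))"
  proof (rule differentiable_bound_general[where f = "\<lambda>t. f (of_real t * w)" and \<phi> = "\<lambda>t. - K * ln (1 - t)"
        and f' = "\<lambda>t. deriv f (of_real t * w) * w" and \<phi>' = "\<lambda>t. K / (1 - t)"])
    show "continuous_on {\<rho>..r} (\<lambda>t. f (of_real t * w))"
      by (rule continuous_on_compose2[OF holomorphic_on_imp_continuous_on[OF f]])
        (use in_disc in \<open>auto intro!: continuous_intros\<close>)
    show "continuous_on {\<rho>..r} (\<lambda>t. - K * ln (1 - t))"
      using rho by (auto intro!: continuous_intros)
    fix t assume t: "\<rho> < t" "t < r"
    have "(f has_field_derivative deriv f (of_real t * w)) (at (of_real t * w))"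
      using in_disc[of t] t by (intro holomorphic_derivI[OF f]) auto
    moreover have "((\<lambda>t. of_real t * w) has_vector_derivative w) (at t)"
      by (auto simp: has_vector_derivative_def scaleR_conv_of_real intro!: derivative_eq_intros)
    ultimately show "((\<lambda>t. f (of_real t * w)) has_vector_derivative deriv f (of_real t * w) * w) (at t)"
      using field_vector_diff_chain_at[where f = "\<lambda>t. of_real t * w" and g = f and x = t]
      by (simp add: o_def mult.commute)
    show "((\<lambda>t. - K * ln (1 - t)) has_vector_derivative K / (1 - t)) (at t)"
      using t rho by (auto intro!: derivative_eq_intros simp: has_real_derivative_iff_has_vector_derivative[symmetric])
    show "cmod (deriv f (of_real t * w) * w) \<le> K / (1 - t)"
      using K[OF t] t rho w by (simp add: norm_mult field_simps)
  qed (use False rho in auto)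
  also have "\<dots> = K * ln ((1 - \<rho>) / (1 - r))"
    using rho False by (simp add: ln_div algebra_simps)
  finally show ?thesis .
qed

text \<open>The radial part of the path gives the logarithm. The chord has length at most
  \<open>l / 2\<close> and the derivative on it is at most \<open>K / l\<close>, which gives the
  \<open>1 / 2\<close>. The chord dips below the top of the square, hence the window
  \<open>2 * l\<close> in the hypothesis.\<close>

lemma carleson_square_oscillation:
  assumes f: "f holomorphic_on unit_disc" and I: "I \<in> circle_arcs" and "0 \<le> K"
    and l: "l = measure circle_measure I"
    and K: "\<And>z. z \<in> unit_disc \<Longrightarrow> 1 - cmod z < 2 * l \<Longrightarrow> (1 - cmod z) * cmod (deriv f z) \<le> K"
  shows "\<exists>c. \<forall>z\<in>carleson_square I. cmod (f z - c) \<le> K * (1 / 2 + ln (min 1 l / (1 - cmod z)))"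
proof -
  obtain S a b where S: "I = cis ` S" "a < b" "b \<le> a + 2 * pi" "{a<..<b} \<subseteq> S" "S \<subseteq> {a..b}"
    using I by (auto simp: circle_arcs_def)
  have lab: "l = b - a"
    using S measure_circle_arc[OF S(2-5)] l by simp
  \<comment> \<open>The base point \<open>\<rho> * cis \<theta>\<close> is the middle of the top of
    the square; it is the origin when the arc has length at least 1.\<close>
  define m \<rho> \<theta> where "m = min 1 l" and "\<rho> = 1 - m" and "\<theta> = (a + b) / 2"
  have m: "0 < m" "m \<le> 1" "m \<le> l" using S(2) lab by (auto simp: m_def)
  have "cmod (f z - f (\<rho> * cis \<theta>)) \<le> K * (1 / 2 + ln (m / (1 - cmod z)))"
    if z: "z \<in> carleson_square I" for z
  proof -
    define r where "r = cmod z"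
    have r: "0 < r" "r < 1" "1 - r < l" using z by (auto simp: carleson_square_def r_def l)
    obtain t where t: "t \<in> S" "z / r = cis t"
      using z by (auto simp: carleson_square_def r_def S(1))
    have zr: "z = r * cis t" using t(2) r by (simp add: field_simps)
    have tab: "\<bar>t - \<theta>\<bar> \<le> l / 2"
    proof -
      have "a \<le> t" "t \<le> b" using t(1) S(5) by auto
      then show ?thesis unfolding lab \<theta>_def by (simp add: abs_le_iff field_simps)
    qed
    have 1: "cmod (f (r * cis t) - f (\<rho> * cis t)) \<le> K * ln ((1 - \<rho>) / (1 - r))"
    proof (rule radial_growth[OF f])
      fix s assume s: "\<rho> < s" "s < r"
      have "(1 - cmod (s * cis t)) * cmod (deriv f (s * cis t)) \<le> K"
        using s m r by (intro K) (auto simp: norm_mult \<rho>_def)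
      then show "(1 - s) * cmod (deriv f (s * cis t)) \<le> K"
        using s m by (simp add: norm_mult \<rho>_def)
    qed (use r m in \<open>auto simp: \<rho>_def m_def\<close>)
    have 2: "cmod (f (\<rho> * cis t) - f (\<rho> * cis \<theta>)) \<le> K / 2"
    \<comment> \<open>For \<open>1 \<le> l\<close> both points are the origin and there is no chord
      to follow.\<close>
    proof (cases "1 \<le> l")
      case True
      then show ?thesis using \<open>0 \<le> K\<close> by (simp add: \<rho>_def m_def)
    next
      case False
      then have ml: "m = l" "0 < \<rho>" by (auto simp: m_def \<rho>_def)
      let ?p = "\<rho> * cis t" and ?q = "\<rho> * cis \<theta>"
      have "cmod (?p - ?q) = \<rho> * cmod (cis t - cis \<theta>)"
        using ml by (simp add: norm_mult flip: right_diff_distrib)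
      also have "\<dots> \<le> 1 * (l / 2)"
        using norm_cis_diff_le[of t \<theta>] tab m ml by (intro mult_mono) (auto simp: \<rho>_def)
      finally have pq: "cmod (?p - ?q) \<le> l / 2" by simp
      have seg: "w \<in> unit_disc \<and> cmod (deriv f w) \<le> K / l" if w: "w \<in> closed_segment ?p ?q" for w
      proof -
        \<comment> \<open>Convexity of the disc of radius \<rho> gives
          \<open>l \<le> 1 - cmod w\<close> on the chord, which turns the hypothesis into the bound
          \<open>K / l\<close>.\<close>
        have "closed_segment ?p ?q \<subseteq> cball 0 \<rho>"
          using ml by (intro closed_segment_subset) (auto simp: norm_mult)
        then have w1: "cmod w \<le> \<rho>" using w by auto
        \<comment> \<open>The chord descends by at most its own length \<open>l / 2\<close>, so
          \<open>1 - cmod w\<close> is at most \<open>3 * l / 2\<close>.\<close>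
        have "cmod (w - ?p) \<le> cmod (?p - ?q)"
          using segment_bound(1)[OF w] by (simp add: norm_minus_commute)
        moreover have "\<rho> - cmod w \<le> cmod (w - ?p)"
          using norm_triangle_ineq2[of ?p w] ml by (simp add: norm_mult norm_minus_commute)
        ultimately have "1 - cmod w < 2 * l"
          using pq m ml by (simp add: \<rho>_def)
        moreover have wd: "w \<in> unit_disc" using w1 m by (simp add: \<rho>_def)
        ultimately have "(1 - cmod w) * cmod (deriv f w) \<le> K" by (intro K)
        moreover have "l * cmod (deriv f w) \<le> (1 - cmod w) * cmod (deriv f w)"
          using w1 ml by (intro mult_right_mono) (auto simp: \<rho>_def)
        ultimately show ?thesis using m wd by (simp add: field_simps)
      qed
      have "cmod (f ?p - f ?q) \<le> K / l * cmod (?p - ?q)"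
      proof (rule field_differentiable_bound)
        fix w assume "w \<in> closed_segment ?p ?q"
        then show "(f has_field_derivative deriv f w) (at w within closed_segment ?p ?q)" "cmod (deriv f w) \<le> K / l"
          using seg[of w] by (auto intro!: DERIV_subset[OF holomorphic_derivI[OF f]])
      qed auto
      also have "\<dots> \<le> K / l * (l / 2)"
        using pq \<open>0 \<le> K\<close> m by (intro mult_left_mono) auto
      finally show ?thesis using m by simp
    qed
    have "cmod (f z - f (\<rho> * cis \<theta>)) \<le> K * ln ((1 - \<rho>) / (1 - r)) + K / 2"
      using norm_triangle_mono[OF 1 2] zr by simp
    then show ?thesis by (simp add: \<rho>_def r_def algebra_simps)
  qed
  then show ?thesis unfolding m_def by blast
qed

text \<open>\<open>K * ln x\<close> is the convex combination of 0 and \<open>ln x / 2\<close> with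
  weight \<open>2 * K\<close>, which is why \<open>K \<le> 1 / 2\<close> is assumed. A bound affine
  in \<open>K\<close> keeps the averages at \<open>1 + O(K)\<close>.\<close>

lemma exp_mult_le_sqrt:
  fixes x K :: real
  assumes "0 < x" "0 \<le> K" "K \<le> 1 / 2"
  shows "exp (K * ln x) \<le> 1 - 2 * K + 2 * K * sqrt x"
proof -
  have "exp ((1 - 2 * K) *\<^sub>R 0 + (2 * K) *\<^sub>R (ln x / 2)) \<le> (1 - 2 * K) * exp 0 + 2 * K * exp (ln x / 2)"
    using assms by (intro convex_onD[OF exp_convex]) auto
  moreover have "exp (ln x / 2) = sqrt x"
    using assms by (simp flip: ln_sqrt)
  ultimately show ?thesis by simp
qed

text \<open>The sign \<open>s\<close> treats \<open>exp (Re f)\<close> and its reciprocal at once.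
  The factor \<open>1 + 6 * K\<close> is \<open>(1 - 2 * K) + 2 * K * 4\<close>, with 4 from
  \<open>area_average_sqrt_carleson_square\<close>.\<close>

lemma area_average_exp_le:
  assumes f: "f holomorphic_on unit_disc" and I: "I \<in> circle_arcs" and K0: "0 \<le> K" "K \<le> 1 / 2"
    and osc: "\<forall>z\<in>carleson_square I. cmod (f z - c) \<le> K * (1 / 2 + ln (min 1 (measure circle_measure I) / (1 - cmod z)))"
    and s: "\<bar>s\<bar> = 1"
  shows "area_average (carleson_square I) (\<lambda>z. exp (s * Re (f z))) \<le> ennreal (exp (s * Re c) * (exp (K / 2) * (1 + 6 * K)))"
proof -
  let ?Q = "carleson_square I" and ?E = "exp (s * Re c) * exp (K / 2)"
  define l where "l = measure circle_measure I"
  note arc = emeasure_arc_measure[OF I, folded l_def]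
  have Ib: "I \<in> sets borel" by (rule sets_circle_arc[OF I])
  have "exp (s * Re (f z)) \<le> ?E * (1 - 2 * K) + ?E * (2 * K) * sqrt (min 1 l / (1 - cmod z))"
    if z: "z \<in> ?Q" for z
  proof -
    have x: "0 < min 1 l / (1 - cmod z)"
      using z arc by (auto simp: carleson_square_def)
    have "s * Re (f z) - s * Re c \<le> \<bar>s * Re (f z - c)\<bar>"
      by (simp add: algebra_simps)
    also have "\<dots> \<le> cmod (f z - c)"
      unfolding abs_mult s using abs_Re_le_cmod[of "f z - c"] by simp
    also have "\<dots> \<le> K / 2 + K * ln (min 1 l / (1 - cmod z))"
      using osc z by (auto simp: l_def algebra_simps)
    finally have "exp (s * Re (f z)) \<le> exp (s * Re c + K / 2 + K * ln (min 1 l / (1 - cmod z)))"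
      by simp
    also have "\<dots> = ?E * exp (K * ln (min 1 l / (1 - cmod z)))"
      by (simp add: exp_add)
    also have "\<dots> \<le> ?E * (1 - 2 * K + 2 * K * sqrt (min 1 l / (1 - cmod z)))"
      using exp_mult_le_sqrt[OF x K0] by (intro mult_left_mono) auto
    finally show ?thesis by (simp add: algebra_simps)
  qed
  then have "area_average ?Q (\<lambda>z. exp (s * Re (f z)))
      \<le> area_average ?Q (\<lambda>z. ?E * (1 - 2 * K) * 1 + ?E * (2 * K) * sqrt (min 1 l / (1 - cmod z)))"
    by (intro area_average_mono) simp
  also have "\<dots> = ennreal (?E * (1 - 2 * K)) * area_average ?Q (\<lambda>_. 1) +
      ennreal (?E * (2 * K)) * area_average ?Q (\<lambda>z. sqrt (min 1 l / (1 - cmod z)))"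
    using K0 arc
    by (intro area_average_linear sets_carleson_square Ib carleson_square_subset
          borel_measurable_disc_area_borel) (auto simp: carleson_square_def)
  also have "area_average ?Q (\<lambda>_. 1) = 1"
    using arc by (intro area_average_one sets_carleson_square Ib carleson_square_subset emeasure_carleson_square_pos)
  also have "ennreal (?E * (1 - 2 * K)) * 1 + ennreal (?E * (2 * K)) * area_average ?Q (\<lambda>z. sqrt (min 1 l / (1 - cmod z)))
      \<le> ennreal (?E * (1 - 2 * K)) + ennreal (?E * (2 * K)) * ennreal 4"
    using area_average_sqrt_carleson_square[OF Ib arc] by (simp add: add_left_mono mult_left_mono)
  also have "\<dots> = ennreal (?E * (1 - 2 * K) + ?E * (2 * K) * 4)"
    using K0 by (subst ennreal_mult'[symmetric], simp, subst ennreal_plus[symmetric]) auto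
  also have "?E * (1 - 2 * K) + ?E * (2 * K) * 4 = exp (s * Re c) * (exp (K / 2) * (1 + 6 * K))"
    by (simp add: algebra_simps)
  finally show ?thesis .
qed

text \<open>The factors \<open>exp (Re c)\<close> and \<open>exp (- Re c)\<close> cancel. The
  remaining bound is finite for (i) and tends to 1 with \<open>K\<close> for (ii); the second
  conclusion serves integrability of the weight.\<close>

lemma area_average_exp_product_le:
  assumes f: "f holomorphic_on unit_disc" and I: "I \<in> circle_arcs" and K0: "0 \<le> K" "K \<le> 1 / 2"
    and K: "\<And>z. z \<in> unit_disc \<Longrightarrow> 1 - cmod z < 2 * measure circle_measure I \<Longrightarrow> (1 - cmod z) * cmod (deriv f z) \<le> K"
  shows "area_average (carleson_square I) (\<lambda>z. exp (Re (f z))) * area_average (carleson_square I) (\<lambda>z. exp (- Re (f z)))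
     \<le> ennreal ((exp (K / 2) * (1 + 6 * K))\<^sup>2)"
    and "area_average (carleson_square I) (\<lambda>z. exp (Re (f z))) < \<infinity>"
proof -
  obtain c where c: "\<forall>z\<in>carleson_square I. cmod (f z - c) \<le> K * (1 / 2 + ln (min 1 (measure circle_measure I) / (1 - cmod z)))"
    using carleson_square_oscillation[OF f I K0(1) refl K] by auto
  note le = area_average_exp_le[OF f I K0 c]
  have "area_average (carleson_square I) (\<lambda>z. exp (Re (f z))) * area_average (carleson_square I) (\<lambda>z. exp (- Re (f z)))
     \<le> ennreal (exp (Re c) * (exp (K / 2) * (1 + 6 * K))) * ennreal (exp (- Re c) * (exp (K / 2) * (1 + 6 * K)))"
    using le[of 1] le[of "-1"] by (intro mult_mono) auto
  also have "\<dots> = ennreal ((exp (K / 2) * (1 + 6 * K))\<^sup>2)"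
    using K0 by (subst ennreal_mult[symmetric]) (auto simp: exp_minus power2_eq_square)
  finally show "area_average (carleson_square I) (\<lambda>z. exp (Re (f z))) * area_average (carleson_square I) (\<lambda>z. exp (- Re (f z)))
     \<le> ennreal ((exp (K / 2) * (1 + 6 * K))\<^sup>2)" .
  show "area_average (carleson_square I) (\<lambda>z. exp (Re (f z))) < \<infinity>"
    using le_less_trans[OF le[of 1] ennreal_less_top] by simp
qed

section \<open>The derivative is controlled by the averages\<close>

text \<open>Cauchy's formula computes the Fourier coefficient of \<open>F\<close> on the circle at
  frequency 1, and Cauchy's theorem makes the one at frequency -1 vanish. Their sum pairs
  \<open>F\<close> with a cosine, a real function, so the identity passes to
  \<open>Re F\<close>.\<close>

lemma circle_mean_square:
  assumes F: "F holomorphic_on ball z0 R" and rho: "0 < \<rho>" "\<rho> < R"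
  shows "ennreal (pi / 2 * \<rho>\<^sup>2 * (cmod (deriv F z0))\<^sup>2)
    \<le> (\<integral>\<^sup>+t\<in>{0..<2 * pi}. ennreal ((Re (F (z0 + rcis \<rho> t)))\<^sup>2) \<partial>lborel)"
proof -
  define G where "G = (\<lambda>t. F (z0 + of_real \<rho> * cis t))"
  define D where "D = deriv F z0"
  \<comment> \<open>Rotating by the argument of the derivative makes the right-hand side of the
    pairing real and nonnegative.\<close>
  define \<alpha> where "\<alpha> = Arg D"
  have D: "D = of_real (cmod D) * cis \<alpha>"
    using rcis_cmod_Arg[of D] by (simp add: \<alpha>_def rcis_def)
  have contG: "continuous_on A G" for A
    unfolding G_def
    by (rule continuous_on_compose2[OF holomorphic_on_imp_continuous_on[OF F]])
       (use rho in \<open>auto intro!: continuous_intros simp: dist_norm norm_mult\<close>)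
  have "((\<lambda>u. F u / (u - z0) ^ Suc 1) has_contour_integral (2 * pi * \<i> / fact 1 * (deriv ^^ 1) F z0)) (circlepath z0 \<rho>)"
    using rho F
    by (intro Cauchy_has_contour_integral_higher_derivative_circlepath)
       (auto intro!: holomorphic_on_imp_continuous_on intro: holomorphic_on_subset)
  then have A: "((\<lambda>t. G t / (\<rho> * cis t) ^ 2 * \<rho> * \<i> * cis t) has_integral (2 * pi * \<i> * D)) {0..2 * pi}"
    unfolding circlepath_def
    by (subst (asm) has_contour_integral_part_circlepath_iff) (auto simp: G_def D_def numeral_2_eq_2)
  have e1: "cis (- \<alpha>) * \<rho> / \<i> * (2 * pi * \<i> * D) = of_real (2 * pi * \<rho> * cmod D)"
    by (subst D) (simp add: cis_mult field_simps)
  have e2: "cis (- \<alpha>) * \<rho> / \<i> * (G t / (\<rho> * cis t) ^ 2 * \<rho> * \<i> * cis t) = G t * cis (- (t + \<alpha>))" for t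
  proof -
    have "cis (- (t + \<alpha>)) = cis (- \<alpha>) / cis t" by (simp add: cis_divide add.commute)
    then show ?thesis using rho by (simp add: power2_eq_square field_simps)
  qed
  have 1: "((\<lambda>t. G t * cis (- (t + \<alpha>))) has_integral (of_real (2 * pi * \<rho> * cmod D))) {0..2 * pi}"
    using has_integral_mult_right[OF A, of "cis (- \<alpha>) * \<rho> / \<i>"] by (simp only: e1 e2)
  have "(F has_contour_integral 0) (circlepath z0 \<rho>)"
    using F rho by (intro Cauchy_theorem_convex_simple[of F "ball z0 R"]) (auto simp: dist_norm)
  then have "((\<lambda>t. G t * \<rho> * \<i> * cis t) has_integral 0) {0..2 * pi}"
    unfolding circlepath_def
    by (subst (asm) has_contour_integral_part_circlepath_iff) (auto simp: G_def)
  from has_integral_mult_right[OF this, of "cis \<alpha> / (\<rho> * \<i>)"]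
  have 2: "((\<lambda>t. G t * cis (t + \<alpha>)) has_integral 0) {0..2 * pi}"
    using rho by (simp add: cis_mult[symmetric] field_simps)
  have B: "((\<lambda>t. G t * cis (- (t + \<alpha>)) + G t * cis (t + \<alpha>)) has_integral (of_real (2 * pi * \<rho> * cmod D))) {0..2 * pi}"
    using has_integral_add[OF 1 2] by simp
  have e3: "Re (G t * cis (- (t + \<alpha>)) + G t * cis (t + \<alpha>)) = 2 * cos (t + \<alpha>) * Re (G t)" for t
    by (simp del: minus_add_distrib)
  from has_integral_Re[OF B]
  have 3: "((\<lambda>t. 2 * cos (t + \<alpha>) * Re (G t)) has_integral (2 * pi * \<rho> * cmod D)) {0..2 * pi}"
    by (simp only: e3 Re_complex_of_real)
  (* Completing the square with s * cos (t + \<alpha>) and bounding cos\<^sup>2 by 1 halves the sharp constant pi. *)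
  define s where "s = \<rho> * cmod D / 2"
  have 4: "((\<lambda>t. s * (2 * cos (t + \<alpha>) * Re (G t)) - s\<^sup>2) has_integral
      (s * (2 * pi * \<rho> * cmod D) - 2 * pi * s\<^sup>2)) {0..2 * pi}"
    using has_integral_diff[OF has_integral_mult_right[OF 3] has_integral_const_real[of "s\<^sup>2" 0 "2 * pi"]]
    by simp
  have "(\<lambda>t. (Re (G t))\<^sup>2) integrable_on {0..2 * pi}"
    by (intro integrable_continuous_real continuous_intros contG)
  then have 5: "((\<lambda>t. (Re (G t))\<^sup>2) has_integral integral {0..2 * pi} (\<lambda>t. (Re (G t))\<^sup>2)) {0..2 * pi}"
    by (rule integrable_integral)
  have "s * (2 * pi * \<rho> * cmod D) - 2 * pi * s\<^sup>2 \<le> integral {0..2 * pi} (\<lambda>t. (Re (G t))\<^sup>2)"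
  proof (rule has_integral_le[OF 4 5])
    fix t
    have "(s * cos (t + \<alpha>))\<^sup>2 \<le> s\<^sup>2"
      by (simp add: power_mult_distrib mult_left_le abs_square_le_1)
    moreover have "0 \<le> (Re (G t) - s * cos (t + \<alpha>))\<^sup>2" by simp
    ultimately show "s * (2 * cos (t + \<alpha>) * Re (G t)) - s\<^sup>2 \<le> (Re (G t))\<^sup>2"
      by (simp add: power2_eq_square algebra_simps)
  qed
  also have "s * (2 * pi * \<rho> * cmod D) - 2 * pi * s\<^sup>2 = pi / 2 * \<rho>\<^sup>2 * (cmod D)\<^sup>2"
    by (simp add: s_def power2_eq_square field_simps)
  finally have "ennreal (pi / 2 * \<rho>\<^sup>2 * (cmod D)\<^sup>2) \<le> ennreal (integral {0..2 * pi} (\<lambda>t. (Re (G t))\<^sup>2))"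
    by (rule ennreal_leI)
  also have "\<dots> = (\<integral>\<^sup>+t\<in>{0<..<2 * pi}. ennreal ((Re (G t))\<^sup>2) \<partial>lborel)"
    by (intro nn_integral_Ioo_has_integral[symmetric] 5 borel_measurable_continuous_onI continuous_intros contG) auto
  also have "\<dots> \<le> (\<integral>\<^sup>+t\<in>{0..<2 * pi}. ennreal ((Re (G t))\<^sup>2) \<partial>lborel)"
    by (intro nn_integral_mono) (auto split: split_indicator)
  finally show ?thesis by (simp add: G_def D_def rcis_def)
qed

text \<open>The bound on the circle of radius \<open>r\<close> times the Jacobian \<open>r\<close>
  gives \<open>pi / 2 * r ^ 3\<close>, whose integral up to \<open>R\<close> is
  \<open>pi / 8 * R ^ 4\<close>.\<close>

lemma disc_mean_square:
  assumes F: "F holomorphic_on ball z0 R" and R: "0 < R"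
  shows "ennreal (pi / 8 * R ^ 4 * (cmod (deriv F z0))\<^sup>2) \<le> (\<integral>\<^sup>+z\<in>ball z0 R. ennreal ((Re (F z))\<^sup>2) \<partial>lborel)"
proof -
  let ?d = "(cmod (deriv F z0))\<^sup>2"
  \<comment> \<open>Extension by zero gives a Borel function on the whole plane, to which polar
    coordinates and translation apply.\<close>
  define g where "g = (\<lambda>z. ennreal (indicator (ball z0 R) z *\<^sub>R (Re (F z))\<^sup>2))"
  have g[measurable]: "g \<in> borel_measurable borel"
    unfolding g_def
    by (intro measurable_compose[OF _ measurable_ennreal] borel_measurable_continuous_on_indicator
        continuous_intros holomorphic_on_imp_continuous_on F) auto
  have "ennreal (pi / 8 * R ^ 4 * ?d) = ennreal (pi / 8 * ?d * R ^ 4 - pi / 8 * ?d * 0 ^ 4)"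
    by (simp add: mult_ac)
  also have "\<dots> = (\<integral>\<^sup>+r\<in>{0<..<R}. ennreal (pi / 2 * ?d * r ^ 3) \<partial>lborel)"
    using R by (intro nn_integral_Ioo_FTC[symmetric])
      (auto intro!: continuous_intros derivative_eq_intros simp: zero_le_mult_iff)
  also have "\<dots> \<le> (\<integral>\<^sup>+r\<in>{0<..}. ennreal r * (\<integral>\<^sup>+t\<in>{0..<2 * pi}. g (z0 + rcis r t) \<partial>lborel) \<partial>lborel)"
  proof (rule nn_integral_mono)
    fix r
    show "ennreal (pi / 2 * ?d * r ^ 3) * indicator {0<..<R} r
       \<le> ennreal r * (\<integral>\<^sup>+t\<in>{0..<2 * pi}. g (z0 + rcis r t) \<partial>lborel) * indicator {0<..} r"
    proof (cases "0 < r \<and> r < R")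
      case True
      have "ennreal (pi / 2 * ?d * r ^ 3) = ennreal r * ennreal (pi / 2 * r\<^sup>2 * ?d)"
        using True by (subst ennreal_mult'[symmetric]) (auto simp: power2_eq_square power3_eq_cube mult_ac)
      also have "\<dots> \<le> ennreal r * (\<integral>\<^sup>+t\<in>{0..<2 * pi}. ennreal ((Re (F (z0 + rcis r t)))\<^sup>2) \<partial>lborel)"
        using True by (intro mult_left_mono circle_mean_square[OF F]) auto
      also have "(\<integral>\<^sup>+t\<in>{0..<2 * pi}. ennreal ((Re (F (z0 + rcis r t)))\<^sup>2) \<partial>lborel)
          = (\<integral>\<^sup>+t\<in>{0..<2 * pi}. g (z0 + rcis r t) \<partial>lborel)"
        using True by (intro nn_integral_cong) (auto simp: g_def dist_norm)
      finally show ?thesis using True by simp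
    qed auto
  qed
  also have "\<dots> = (\<integral>\<^sup>+z. g (z0 + z) \<partial>lborel)"
    by (rule nn_integral_polar'[symmetric]) measurable
  also have "\<dots> = (\<integral>\<^sup>+z. g z \<partial>lborel)"
    by (subst (2) lborel_distr_plus[of z0, symmetric], subst nn_integral_distr) auto
  also have "\<dots> = (\<integral>\<^sup>+z\<in>ball z0 R. ennreal ((Re (F z))\<^sup>2) \<partial>lborel)"
    by (intro nn_integral_cong) (auto simp: g_def split: split_indicator)
  finally show ?thesis .
qed

text \<open>The right-hand side minus 2 is \<open>4 * (sinh (x / 2))\<^sup>2\<close>, and
  \<open>sinh y\<close> dominates \<open>y\<close> for nonnegative \<open>y\<close>.\<close>

lemma exp_plus_exp_minus_ge: "(x::real)\<^sup>2 + 2 \<le> exp x + exp (- x)"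
proof -
  have *: "y \<le> sinh y" if "0 \<le> y" for y :: real
  proof -
    have "sinh 0 - 0 \<le> sinh y - y"
      by (rule DERIV_nonneg_imp_nondecreasing[OF that, of "\<lambda>y. sinh y - y"])
         (auto intro!: derivative_eq_intros exI simp: cosh_real_ge_1)
    then show ?thesis by simp
  qed
  have "(x / 2)\<^sup>2 \<le> (sinh (x / 2))\<^sup>2"
    using *[of "\<bar>x / 2\<bar>"] by (cases "0 \<le> x") (auto simp: abs_le_square_iff[symmetric])
  also have "(sinh (x / 2))\<^sup>2 = (exp x + exp (- x) - 2) / 4"
    by (simp add: sinh_field_def power2_eq_square field_simps flip: exp_add)
  finally show ?thesis by (simp add: power2_eq_square)
qed

lemma borel_measurable_Re_holomorphic:
  assumes "f holomorphic_on unit_disc"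
  shows "(\<lambda>z. Re (f z)) \<in> borel_measurable (lebesgue_on unit_disc)"
  by (intro continuous_imp_measurable_on_sets_lebesgue continuous_intros
      holomorphic_on_imp_continuous_on assms) auto

lemma area_variance_le:
  assumes Q: "Q \<in> sets borel" "Q \<subseteq> unit_disc" "0 < emeasure disc_area Q"
    and u[measurable]: "u \<in> borel_measurable (lebesgue_on unit_disc)"
    and p: "area_average Q (\<lambda>z. exp (u z)) * area_average Q (\<lambda>z. exp (- u z)) \<le> ennreal p"
  shows "1 \<le> p" "\<exists>c. area_average Q (\<lambda>z. (u z - c)\<^sup>2) \<le> ennreal (p - 1)"
proof -
  let ?\<alpha> = "area_average Q (\<lambda>z. exp (u z))" and ?\<beta> = "area_average Q (\<lambda>z. exp (- u z))"
  have pos: "0 < ?\<alpha>" "0 < ?\<beta>"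
    by (auto intro!: area_average_pos Q)
  have "?\<alpha> * ?\<beta> \<noteq> top" using p by (auto simp: top_unique)
  then have "?\<alpha> \<noteq> top" "?\<beta> \<noteq> top"
    using pos by (auto simp: ennreal_mult_eq_top_iff)
  then obtain a b where ab: "?\<alpha> = ennreal a" "0 \<le> a" "?\<beta> = ennreal b" "0 \<le> b"
    by (metis ennreal_cases)
  with pos have ab0: "0 < a" "0 < b" by (auto simp: ennreal_less_zero_iff)
  have "ennreal (a * b) \<le> ennreal p"
    using p ab by (simp add: ennreal_mult)
  with ab0 have abp: "a * b \<le> p"
    by (metis ennreal_le_iff2 mult_pos_pos not_le order.strict_implies_order)
  \<comment> \<open>This choice of \<open>c\<close> makes the average of \<open>exp (u - c)\<close>
    equal to 1 and that of \<open>exp (c - u)\<close> equal to the product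
    \<open>a * b\<close>.\<close>
  define c where "c = ln a"
  \<comment> \<open>The 2 stays on the left, which avoids truncated subtraction in
    \<open>ennreal\<close>. The odd shape of both sides matches
    \<open>area_average_linear\<close>.\<close>
  have "area_average Q (\<lambda>z. 2 * 1 + 1 * (u z - c)\<^sup>2) \<le> area_average Q (\<lambda>z. (1 / a) * exp (u z) + a * exp (- u z))"
  proof (rule area_average_mono)
    fix z
    have "(u z - c)\<^sup>2 + 2 \<le> exp (u z - c) + exp (- (u z - c))"
      by (rule exp_plus_exp_minus_ge)
    also have "\<dots> = (1 / a) * exp (u z) + a * exp (- u z)"
      using ab0 by (simp add: c_def exp_diff exp_minus field_simps)
    finally show "2 * 1 + 1 * (u z - c)\<^sup>2 \<le> (1 / a) * exp (u z) + a * exp (- u z)" by simp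
  qed
  also have "\<dots> = ennreal (1 / a) * ?\<alpha> + ennreal a * ?\<beta>"
    using ab0 by (intro area_average_linear Q) auto
  also have "\<dots> = ennreal (1 + a * b)"
    unfolding ab using ab0 by (simp add: ennreal_mult'[symmetric])
  also have "\<dots> \<le> ennreal (1 + p)"
    using abp by (intro ennreal_leI) simp
  also have "area_average Q (\<lambda>z. 2 * 1 + 1 * (u z - c)\<^sup>2)
      = ennreal 2 * area_average Q (\<lambda>z. 1) + ennreal 1 * area_average Q (\<lambda>z. (u z - c)\<^sup>2)"
    by (intro area_average_linear Q) auto
  finally have le: "2 + area_average Q (\<lambda>z. (u z - c)\<^sup>2) \<le> ennreal (1 + p)"
    by (simp add: area_average_one[OF Q])
  moreover have "2 \<le> 2 + area_average Q (\<lambda>z. (u z - c)\<^sup>2)" by simp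
  ultimately have "ennreal 2 \<le> ennreal (1 + p)"
    by (metis ennreal_numeral order_trans)
  then show p1: "1 \<le> p"
    by (subst (asm) ennreal_le_iff2) auto
  have "area_average Q (\<lambda>z. (u z - c)\<^sup>2) \<noteq> top"
  proof
    assume "area_average Q (\<lambda>z. (u z - c)\<^sup>2) = top"
    then show False using le by (simp add: top_unique)
  qed
  then obtain v where v: "area_average Q (\<lambda>z. (u z - c)\<^sup>2) = ennreal v" "0 \<le> v"
    by (metis ennreal_cases)
  then have "ennreal (2 + v) \<le> ennreal (1 + p)"
    using le by (subst ennreal_plus) auto
  then have "v \<le> p - 1" using p1 by (subst (asm) ennreal_le_iff) auto
  then show "\<exists>c. area_average Q (\<lambda>z. (u z - c)\<^sup>2) \<le> ennreal (p - 1)"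
    using v by (intro exI[of _ c]) (simp add: ennreal_leI)
qed

text \<open>Subtracting the constant \<open>c\<close> leaves the derivative unchanged, so
  \<open>disc_mean_square\<close> bounds it by the integral of \<open>(Re f - c)\<^sup>2\<close>
  over the ball, and \<open>area_variance_le\<close> bounds that integral over all of
  \<open>Q\<close>.\<close>

lemma deriv_bound_of_area_product:
  assumes f: "f holomorphic_on unit_disc"
    and Q: "Q \<in> sets borel" "Q \<subseteq> unit_disc" "ball z r \<subseteq> Q" "0 < r"
    and p: "area_average Q (\<lambda>z. exp (Re (f z))) * area_average Q (\<lambda>z. exp (- Re (f z))) \<le> ennreal p"
  shows "r ^ 4 * (cmod (deriv f z))\<^sup>2 \<le> 8 * (p - 1) * measure disc_area Q"
proof -
  have "emeasure disc_area (ball z r) > 0"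
  proof -
    have "ball z r \<subseteq> unit_disc" using Q by blast
    then show ?thesis using Q(4)
      by (subst emeasure_disc_area) (auto simp: emeasure_ball unit_ball_vol_2 divide_ennreal)
  qed
  also have "\<dots> \<le> emeasure disc_area Q"
    using Q by (intro emeasure_mono) (auto simp: sets_disc_area sets_restrict_space_iff)
  finally have AQ: "0 < emeasure disc_area Q" .
  have Afin: "emeasure disc_area Q = ennreal (measure disc_area Q)"
    using emeasure_disc_area_finite[OF Q(1,2)] by (intro emeasure_eq_ennreal_measure) auto
  note var = area_variance_le[OF Q(1,2) AQ borel_measurable_Re_holomorphic[OF f] p]
  obtain c where c: "area_average Q (\<lambda>z. (Re (f z) - c)\<^sup>2) \<le> ennreal (p - 1)"
    using var(2) by blast
  have zd: "z \<in> unit_disc" using Q(2,3) centre_in_ball[of z r] Q(4) by blast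
  define F where "F = (\<lambda>z. f z - of_real c)"
  have F: "F holomorphic_on ball z r"
    unfolding F_def using f Q by (intro holomorphic_intros) (auto intro: holomorphic_on_subset)
  have dF: "deriv F z = deriv f z"
  proof -
    have "(f has_field_derivative deriv f z) (at z)"
      using zd by (intro holomorphic_derivI[OF f]) auto
    then show ?thesis
      unfolding F_def by (intro DERIV_imp_deriv) (auto intro!: derivative_eq_intros)
  qed
  have "ennreal (pi / 8 * r ^ 4 * (cmod (deriv f z))\<^sup>2) \<le> (\<integral>\<^sup>+z\<in>ball z r. ennreal ((Re (F z))\<^sup>2) \<partial>lborel)"
    using disc_mean_square[OF F Q(4)] dF by simp
  also have "\<dots> \<le> (\<integral>\<^sup>+z\<in>Q. ennreal ((Re (f z) - c)\<^sup>2) \<partial>lborel)"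
    using Q(3) by (intro nn_integral_mono) (auto simp: F_def split: split_indicator)
  finally have "ennreal (pi / 8 * r ^ 4 * (cmod (deriv f z))\<^sup>2) / ennreal pi
      \<le> (\<integral>\<^sup>+z\<in>Q. ennreal ((Re (f z) - c)\<^sup>2) \<partial>disc_area)"
    using borel_measurable_Re_holomorphic[OF f]
    by (subst nn_integral_disc_area_subset[OF _ Q(1,2)]) (auto intro!: divide_right_mono_ennreal)
  also have "\<dots> = area_average Q (\<lambda>z. (Re (f z) - c)\<^sup>2) * emeasure disc_area Q"
    unfolding area_average_def using AQ emeasure_disc_area_finite[OF Q(1,2)]
    by (subst ennreal_divide_times) (simp add: ennreal_divide_self)
  also have "\<dots> \<le> ennreal (p - 1) * ennreal (measure disc_area Q)"
    unfolding Afin by (intro mult_right_mono c) auto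
  finally have "ennreal (r ^ 4 * (cmod (deriv f z))\<^sup>2 / 8) \<le> ennreal ((p - 1) * measure disc_area Q)"
    using var(1) by (simp add: divide_ennreal ennreal_mult'[symmetric])
  moreover have "0 \<le> (p - 1) * measure disc_area Q"
    using var(1) by simp
  ultimately show ?thesis
    by (subst (asm) ennreal_le_iff) (auto simp: algebra_simps)
qed

text \<open>A finite product can itself be taken as \<open>p\<close> in
  \<open>area_variance_le\<close>; an infinite one is large enough.\<close>

lemma area_product_ge_one:
  assumes f: "f holomorphic_on unit_disc" and Q: "Q \<in> sets borel" "Q \<subseteq> unit_disc" "0 < emeasure disc_area Q"
  shows "1 \<le> area_average Q (\<lambda>z. exp (Re (f z))) * area_average Q (\<lambda>z. exp (- Re (f z)))" (is "_ \<le> ?P")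
proof (cases ?P)
  case (real p)
  then have "1 \<le> p"
    by (intro area_variance_le(1)[OF Q borel_measurable_Re_holomorphic[OF f]]) simp
  then show ?thesis unfolding real(2) by (simp add: ennreal_ge_1)
qed auto

text \<open>A disc of radius \<open>l / 8\<close> inside a square of area at most
  \<open>l\<^sup>2 / 2\<close> gives \<open>l * cmod (deriv f z) \<le> 128 * sqrt (p - 1)\<close>,
  where \<open>128\<^sup>2 = 4 * 8 ^ 4\<close>. Dividing by 4 gives 32, as
  \<open>l = 4 * (1 - cmod z)\<close>.\<close>

lemma bloch_bound_of_area_product:
  assumes f: "f holomorphic_on unit_disc" and z: "cmod z < 1" "3 / 4 \<le> cmod z"
    and p: "\<And>I. I \<in> circle_arcs \<Longrightarrow> measure circle_measure I = 4 * (1 - cmod z) \<Longrightarrow>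
      area_average (carleson_square I) (\<lambda>z. exp (Re (f z))) * area_average (carleson_square I) (\<lambda>z. exp (- Re (f z)))
        \<le> ennreal p"
  shows "1 \<le> p" "(1 - cmod z) * cmod (deriv f z) \<le> 32 * sqrt (p - 1)"
proof -
  define l where "l = 4 * (1 - cmod z)"
  have l: "0 < l" "l \<le> 1" using z by (auto simp: l_def)
  obtain I where I: "I \<in> circle_arcs" "measure circle_measure I = l" "ball z (l / 8) \<subseteq> carleson_square I"
    using carleson_square_near_point[OF z] unfolding l_def by metis
  have Ib: "I \<in> sets borel" by (rule sets_circle_arc[OF I(1)])
  have em: "emeasure circle_measure I = ennreal l"
    using emeasure_arc_measure(1)[OF I(1)] I(2) by simp
  note Q = sets_carleson_square[OF Ib] carleson_square_subset[of I]
  have prod: "area_average (carleson_square I) (\<lambda>z. exp (Re (f z))) * area_average (carleson_square I) (\<lambda>z. exp (- Re (f z)))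
        \<le> ennreal p"
    using p[OF I(1)] I(2) by (simp add: l_def)
  show p1: "1 \<le> p"
    by (rule area_variance_le(1)[OF Q emeasure_carleson_square_pos[OF Ib em l(1)] borel_measurable_Re_holomorphic[OF f] prod])
  have A: "measure disc_area (carleson_square I) \<le> l\<^sup>2 / 2"
  proof -
    have "measure disc_area (carleson_square I) = l * (1 - (1 - l)\<^sup>2) / (2 * pi)"
    proof -
      have "(1 - l)\<^sup>2 \<le> 1" using l by (intro power_le_one) auto
      then show ?thesis
        using emeasure_carleson_square[OF Ib em] l by (simp add: measure_def)
    qed
    also have "\<dots> \<le> l * (2 * l) / (2 * 2)"
    proof (rule frac_le)
      have "1 - (1 - l)\<^sup>2 \<le> 2 * l" by (simp add: power2_eq_square algebra_simps)
      then show "l * (1 - (1 - l)\<^sup>2) \<le> l * (2 * l)" using l by (intro mult_left_mono) auto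
    qed (use l pi_gt3 in auto)
    finally show ?thesis by (simp add: power2_eq_square)
  qed
  have "(l / 8) ^ 4 * (cmod (deriv f z))\<^sup>2 \<le> 8 * (p - 1) * measure disc_area (carleson_square I)"
    using l by (intro deriv_bound_of_area_product[OF f Q I(3) _ prod]) auto
  also have "\<dots> \<le> 8 * (p - 1) * (l\<^sup>2 / 2)"
    using A p1 by (intro mult_left_mono) auto
  finally have "(l\<^sup>2 * (cmod (deriv f z))\<^sup>2) * l\<^sup>2 \<le> (128\<^sup>2 * (p - 1)) * l\<^sup>2"
    by (simp add: field_simps eval_nat_numeral)
  then have "l\<^sup>2 * (cmod (deriv f z))\<^sup>2 \<le> 128\<^sup>2 * (p - 1)"
    by (rule mult_right_le_imp_le) (use l in simp)
  then have "(l * cmod (deriv f z))\<^sup>2 \<le> (128 * sqrt (p - 1))\<^sup>2"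
    using p1 by (simp add: power_mult_distrib)
  then have "l * cmod (deriv f z) \<le> 128 * sqrt (p - 1)"
    using p1 by (intro power2_le_imp_le[of "l * cmod (deriv f z)"]) auto
  moreover have "l * cmod (deriv f z) = 4 * ((1 - cmod z) * cmod (deriv f z))"
    by (simp add: l_def)
  ultimately show "(1 - cmod z) * cmod (deriv f z) \<le> 32 * sqrt (p - 1)"
    by linarith
qed

section \<open>Bloch functions\<close>

text \<open>On the disc \<open>1 - (cmod z)\<^sup>2\<close> lies between \<open>1 - cmod z\<close>
  and twice that.\<close>

lemma bloch_iff:
  assumes f: "f holomorphic_on unit_disc"
  shows "f \<in> bloch \<longleftrightarrow> (\<exists>M. \<forall>z\<in>unit_disc. (1 - cmod z) * cmod (deriv f z) \<le> M)"
proof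
  assume "f \<in> bloch"
  then have "bloch_seminorm f < top" by (simp add: bloch_def)
  then obtain M where M: "bloch_seminorm f = ennreal M" "0 \<le> M"
    by (metis ennreal_cases less_irrefl)
  have "(1 - cmod z) * cmod (deriv f z) \<le> M" if z: "z \<in> unit_disc" for z
  proof -
    have "ennreal ((1 - (cmod z)\<^sup>2) * cmod (deriv f z)) \<le> bloch_seminorm f"
      unfolding bloch_seminorm_def using z by (rule SUP_upper)
    then have "(1 - (cmod z)\<^sup>2) * cmod (deriv f z) \<le> M"
      unfolding M(1) using M(2) by (subst (asm) ennreal_le_iff) auto
    moreover have "(cmod z)\<^sup>2 \<le> cmod z"
      using z by (simp add: power2_eq_square mult_left_le)
    then have "(1 - cmod z) * cmod (deriv f z) \<le> (1 - (cmod z)\<^sup>2) * cmod (deriv f z)"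
      by (intro mult_right_mono) auto
    ultimately show ?thesis by simp
  qed
  then show "\<exists>M. \<forall>z\<in>unit_disc. (1 - cmod z) * cmod (deriv f z) \<le> M" by blast
next
  assume "\<exists>M. \<forall>z\<in>unit_disc. (1 - cmod z) * cmod (deriv f z) \<le> M"
  then obtain M where M: "(1 - cmod z) * cmod (deriv f z) \<le> M" if "z \<in> unit_disc" for z by blast
  have "bloch_seminorm f \<le> ennreal (2 * M)"
    unfolding bloch_seminorm_def
  proof (intro SUP_least ennreal_leI)
    fix z assume z: "z \<in> unit_disc"
    have "(1 - (cmod z)\<^sup>2) * cmod (deriv f z) = (1 + cmod z) * ((1 - cmod z) * cmod (deriv f z))"
      by (simp add: power2_eq_square algebra_simps)
    also have "\<dots> \<le> 2 * M"
      using z M[OF z] by (intro mult_mono) auto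
    finally show "(1 - (cmod z)\<^sup>2) * cmod (deriv f z) \<le> 2 * M" .
  qed
  then have "bloch_seminorm f < top"
    by (rule le_less_trans) simp
  then show "f \<in> bloch" using f by (simp add: bloch_def)
qed

text \<open>On the remaining compact disc the derivative is bounded by continuity.\<close>

lemma blochI_near_boundary:
  assumes f: "f holomorphic_on unit_disc" and "R < 1"
    and M: "\<And>z. z \<in> unit_disc \<Longrightarrow> R < cmod z \<Longrightarrow> (1 - cmod z) * cmod (deriv f z) \<le> M"
  shows "f \<in> bloch"
proof -
  have "continuous_on (cball 0 R) (deriv f)"
    using \<open>R < 1\<close> by (intro holomorphic_on_imp_continuous_on holomorphic_on_subset[OF holomorphic_deriv[OF f]]) auto
  then have "compact (deriv f ` cball 0 R)"
    by (intro compact_continuous_image) auto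
  then obtain B where "\<forall>w\<in>deriv f ` cball 0 R. cmod w \<le> B"
    by (meson bounded_iff compact_imp_bounded)
  then have B: "cmod (deriv f z) \<le> B" if "cmod z \<le> R" for z
    using that by simp
  have "(1 - cmod z) * cmod (deriv f z) \<le> max B M" if z: "z \<in> unit_disc" for z
  proof (cases "R < cmod z")
    case True
    then show ?thesis using M[OF z] by simp
  next
    case False
    then have "cmod (deriv f z) \<le> B" by (intro B) simp
    moreover have "(1 - cmod z) * cmod (deriv f z) \<le> 1 * cmod (deriv f z)"
      by (intro mult_right_mono) auto
    ultimately show ?thesis by simp
  qed
  then show ?thesis using bloch_iff[OF f] by blast
qed

lemma little_bloch_iff:
  assumes f: "f holomorphic_on unit_disc"
  shows "f \<in> little_bloch \<longleftrightarrow>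
    (\<forall>e>0. \<exists>R<1. \<forall>z\<in>unit_disc. R < cmod z \<longrightarrow> (1 - cmod z) * cmod (deriv f z) \<le> e)"
proof
  assume "f \<in> little_bloch"
  then have lim: "((\<lambda>z. (1 - (cmod z)\<^sup>2) * cmod (deriv f z)) \<longlongrightarrow> 0) (filtercomap cmod (at_left 1))"
    by (simp add: little_bloch_def)
  show "\<forall>e>0. \<exists>R<1. \<forall>z\<in>unit_disc. R < cmod z \<longrightarrow> (1 - cmod z) * cmod (deriv f z) \<le> e"
  proof (intro allI impI)
    fix e :: real assume "0 < e"
    with lim have "\<forall>\<^sub>F z in filtercomap cmod (at_left 1). (1 - (cmod z)\<^sup>2) * cmod (deriv f z) < e"
      by (rule order_tendstoD(2))
    then obtain P where P: "eventually P (at_left (1::real))"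
      "\<And>z. P (cmod z) \<Longrightarrow> (1 - (cmod z)\<^sup>2) * cmod (deriv f z) < e"
      by (auto simp: eventually_filtercomap)
    then obtain R where R: "R < 1" "\<And>x. R < x \<Longrightarrow> x < 1 \<Longrightarrow> P x"
      by (auto simp: eventually_at_left[of 0 1] eventually_at_left_field)
    have "(1 - cmod z) * cmod (deriv f z) \<le> e" if z: "z \<in> unit_disc" "R < cmod z" for z
    proof -
      have "(cmod z)\<^sup>2 \<le> cmod z"
        using z by (simp add: power2_eq_square mult_left_le)
      then have "(1 - cmod z) * cmod (deriv f z) \<le> (1 - (cmod z)\<^sup>2) * cmod (deriv f z)"
        by (intro mult_right_mono) auto
      also have "\<dots> < e" using z by (intro P R) auto
      finally show ?thesis by simp
    qed
    with R(1) show "\<exists>R<1. \<forall>z\<in>unit_disc. R < cmod z \<longrightarrow> (1 - cmod z) * cmod (deriv f z) \<le> e" by blast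
  qed
next
  assume R: "\<forall>e>0. \<exists>R<1. \<forall>z\<in>unit_disc. R < cmod z \<longrightarrow> (1 - cmod z) * cmod (deriv f z) \<le> e"
  have "f \<in> bloch"
    using R[rule_format, of 1] blochI_near_boundary[OF f, of _ 1] by (metis zero_less_one)
  moreover have "((\<lambda>z. (1 - (cmod z)\<^sup>2) * cmod (deriv f z)) \<longlongrightarrow> 0) (filtercomap cmod (at_left 1))"
  proof (rule tendstoI)
    fix e :: real assume "0 < e"
    \<comment> \<open>The factor \<open>1 + cmod z\<close> is below 2, so \<open>e / 3\<close>
      leaves room for a strict inequality.\<close>
    then obtain R where R: "R < 1" "\<And>z. z \<in> unit_disc \<Longrightarrow> R < cmod z \<Longrightarrow> (1 - cmod z) * cmod (deriv f z) \<le> e / 3"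
      using R[rule_format, of "e / 3"] by auto
    have "dist ((1 - (cmod z)\<^sup>2) * cmod (deriv f z)) 0 < e" if z: "R < cmod z" "cmod z < 1" for z
    proof -
      have "(1 - (cmod z)\<^sup>2) * cmod (deriv f z) = (1 + cmod z) * ((1 - cmod z) * cmod (deriv f z))"
        by (simp add: power2_eq_square algebra_simps)
      also have "\<dots> \<le> 2 * (e / 3)"
        using z R(2)[of z] by (intro mult_mono) auto
      also have "\<dots> < e" using \<open>0 < e\<close> by simp
      finally show ?thesis using z by (simp add: abs_mult abs_square_le_1)
    qed
    moreover have "\<forall>\<^sub>F x in at_left (1::real). R < x \<and> x < 1"
      using \<open>R < 1\<close> by (auto simp: eventually_at_left_field)
    ultimately show "\<forall>\<^sub>F z in filtercomap cmod (at_left 1). dist ((1 - (cmod z)\<^sup>2) * cmod (deriv f z)) 0 < e"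
      unfolding eventually_filtercomap by blast
  qed
  ultimately show "f \<in> little_bloch" by (simp add: little_bloch_def)
qed

section \<open>The two equivalences\<close>

lemma deriv_cmult_holomorphic:
  assumes "f holomorphic_on unit_disc" "z \<in> unit_disc"
  shows "deriv (\<lambda>z. of_real \<delta> * f z) z = of_real \<delta> * deriv f z"
  using holomorphic_derivI[OF assms(1) open_ball assms(2)]
  by (intro DERIV_imp_deriv DERIV_cmult)

lemma B2_weight_exp_of_bloch:
  assumes "f \<in> bloch"
  shows "\<exists>\<delta>>0. B2_weight (\<lambda>z. exp (\<delta> * Re (f z)))"
proof -
  have f: "f holomorphic_on unit_disc" using assms by (simp add: bloch_def)
  obtain M where M: "(1 - cmod z) * cmod (deriv f z) \<le> M" if "z \<in> unit_disc" for z
    using bloch_iff[OF f] assms by blast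
  \<comment> \<open>Scaling brings the Bloch bound down to \<open>1 / 2\<close>, the largest
    \<open>K\<close> that the convexity estimate allows. The added 1 keeps the denominator
    positive.\<close>
  define \<delta> where "\<delta> = 1 / (2 * (\<bar>M\<bar> + 1))"
  have \<delta>: "0 < \<delta>" "\<delta> * M \<le> 1 / 2"
    by (auto simp: \<delta>_def field_simps)
  define g where "g = (\<lambda>z. of_real \<delta> * f z)"
  have g: "g holomorphic_on unit_disc" unfolding g_def by (intro holomorphic_intros f)
  have Re_g: "Re (g z) = \<delta> * Re (f z)" for z by (simp add: g_def)
  have gK: "(1 - cmod z) * cmod (deriv g z) \<le> 1 / 2" if "z \<in> unit_disc" for z
  proof -
    have "(1 - cmod z) * cmod (deriv g z) = \<delta> * ((1 - cmod z) * cmod (deriv f z))"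
      using \<delta> deriv_cmult_holomorphic[OF f that, of \<delta>] by (simp add: g_def norm_mult)
    also have "\<dots> \<le> \<delta> * M" using M[OF that] \<delta> by (intro mult_left_mono) auto
    finally show ?thesis using \<delta> by simp
  qed
  let ?C = "(exp ((1/2) / 2) * (1 + 6 * (1/2)))\<^sup>2 :: real"
  have bound: "area_average (carleson_square I) (\<lambda>z. exp (Re (g z))) * area_average (carleson_square I) (\<lambda>z. exp (- Re (g z)))
       \<le> ennreal ?C" "area_average (carleson_square I) (\<lambda>z. exp (Re (g z))) < \<infinity>" if "I \<in> circle_arcs" for I
    using area_average_exp_product_le[OF g that, of "1/2"] gK by auto
  have "B2_char_sq (\<lambda>z. exp (Re (g z))) \<le> ennreal ?C"
    unfolding B2_char_sq_def using bound(1) by (intro SUP_least) (simp add: exp_minus[symmetric])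
  then have char: "B2_char_sq (\<lambda>z. exp (Re (g z))) < \<infinity>"
    by (rule le_less_trans) simp
  \<comment> \<open>The full circle counts as an arc. Its square is the disc without the origin, so
    finiteness of this one average yields integrability over the disc.\<close>
  define I where "I = cis ` {0..2 * pi}"
  have I: "I \<in> circle_arcs"
    unfolding circle_arcs_def I_def by (intro CollectI exI[of _ "{0..2 * pi}"] exI[of _ 0] exI[of _ "2 * pi"]) auto
  have QI: "carleson_square I = unit_disc - {0}"
  proof -
    have "measure circle_measure I = 2 * pi"
      unfolding I_def using measure_circle_arc[of 0 "2 * pi" "{0..2 * pi}"] greaterThanLessThan_subseteq_atLeastAtMost_iff[of 0 "2 * pi"]
      by simp
    moreover have "1 - cmod z < 2 * pi" for z
      using pi_gt3 norm_ge_zero[of z] by linarith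
    moreover have "z / cmod z \<in> I" if "z \<noteq> 0" for z
    proof -
      have "z / cmod z = cis (Arg2pi z)"
        using that Arg2pi_eq[of z] by (simp add: cis_conv_exp field_simps)
      moreover have "Arg2pi z \<in> {0..2 * pi}"
        using Arg2pi_ge_0[of z] Arg2pi_lt_2pi[of z] by simp
      ultimately show ?thesis unfolding I_def by blast
    qed
    ultimately show ?thesis by (auto simp: carleson_square_def)
  qed
  have meas: "(\<lambda>z. exp (Re (g z))) \<in> borel_measurable (lebesgue_on unit_disc)"
    using borel_measurable_Re_holomorphic[OF g] by measurable
  have "(\<integral>\<^sup>+z\<in>unit_disc. ennreal (exp (Re (g z))) \<partial>lborel) = (\<integral>\<^sup>+z\<in>unit_disc - {0}. ennreal (exp (Re (g z))) \<partial>lborel)"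
    by (intro nn_integral_cong_AE eventually_mono[OF AE_lborel_singleton[of "0::complex"]])
       (auto simp: indicator_def)
  then have "(\<integral>\<^sup>+z. ennreal (exp (Re (g z))) \<partial>disc_area) = (\<integral>\<^sup>+z\<in>carleson_square I. ennreal (exp (Re (g z))) \<partial>disc_area)"
    unfolding QI using meas
    by (subst nn_integral_disc_area, simp, subst nn_integral_disc_area_subset) auto
  also have "\<dots> < \<infinity>"
    using bound(2)[OF I] emeasure_disc_area_finite[OF sets_carleson_square[OF sets_circle_arc[OF I]] carleson_square_subset]
    unfolding area_average_def
    by (metis ennreal_divide_eq_top_iff infinity_ennreal_def less_top)
  finally have "integrable disc_area (\<lambda>z. exp (Re (g z)))"
    using meas unfolding measurable_cong_sets[OF sets_disc_area[symmetric] refl]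
    by (intro integrableI_nonneg) auto
  with char have "B2_weight (\<lambda>z. exp (Re (g z)))"
    by (simp add: B2_weight_def)
  then show ?thesis using \<delta>(1) unfolding Re_g by blast
qed

lemma bloch_of_B2_weight_exp:
  assumes f: "f holomorphic_on unit_disc" and \<delta>: "0 < \<delta>" and w: "B2_weight (\<lambda>z. exp (\<delta> * Re (f z)))"
  shows "f \<in> bloch"
proof -
  define g where "g = (\<lambda>z. of_real \<delta> * f z)"
  have g: "g holomorphic_on unit_disc" unfolding g_def by (intro holomorphic_intros f)
  have Re_g: "\<delta> * Re (f z) = Re (g z)" for z by (simp add: g_def)
  have "B2_char_sq (\<lambda>z. exp (Re (g z))) < top"
    using w unfolding Re_g by (simp add: B2_weight_def)
  then obtain p where p: "B2_char_sq (\<lambda>z. exp (Re (g z))) = ennreal p"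
    by (metis ennreal_cases less_irrefl)
  have prod: "area_average (carleson_square I) (\<lambda>z. exp (Re (g z))) * area_average (carleson_square I) (\<lambda>z. exp (- Re (g z)))
       \<le> ennreal p" if "I \<in> circle_arcs" for I
    using SUP_upper[OF that, of "\<lambda>I. area_average (carleson_square I) (\<lambda>z. exp (Re (g z))) *
      area_average (carleson_square I) (\<lambda>z. inverse (exp (Re (g z))))"]
    unfolding p[unfolded B2_char_sq_def] by (simp add: exp_minus)
  show ?thesis
  \<comment> \<open>The pointwise bound is available for \<open>3 / 4 \<le> cmod z\<close> only,
    which suffices. It is applied to \<open>\<delta> * f\<close> and divided by \<delta>.\<close>
  proof (rule blochI_near_boundary[OF f])
    fix z assume z: "z \<in> unit_disc" "3 / 4 < cmod z"
    have "(1 - cmod z) * cmod (deriv g z) \<le> 32 * sqrt (p - 1)"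
      using z prod by (intro bloch_bound_of_area_product(2)[OF g]) auto
    moreover have "cmod (deriv g z) = \<delta> * cmod (deriv f z)"
      using \<delta> deriv_cmult_holomorphic[OF f z(1), of \<delta>] by (simp add: g_def norm_mult)
    ultimately show "(1 - cmod z) * cmod (deriv f z) \<le> 32 * sqrt (p - 1) / \<delta>"
      using \<delta> by (simp add: field_simps)
  qed simp
qed

lemma product_tendsto_one_of_little_bloch:
  assumes f: "f holomorphic_on unit_disc" and lb: "f \<in> little_bloch"
  shows "((\<lambda>\<delta>::real. SUP Q\<in>{Q \<in> carleson_squares. measure disc_area Q < \<delta>}.
      area_average Q (\<lambda>z. exp (Re (f z))) * area_average Q (\<lambda>z. exp (- Re (f z)))) \<longlongrightarrow> 1) (at_right 0)"
    (is "(?S \<longlongrightarrow> 1) _")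
proof (rule order_tendstoI)
  \<comment> \<open>Below 1: every product is at least 1, and some square has area less than
    \<delta>.\<close>
  fix a :: ennreal assume a: "a < 1"
  have "a < ?S \<delta>" if d: "0 < \<delta>" for \<delta>
  proof -
    obtain I where I: "I \<in> circle_arcs" "measure disc_area (carleson_square I) < \<delta>"
      using exists_small_carleson_square[OF d] by blast
    have "1 \<le> area_average (carleson_square I) (\<lambda>z. exp (Re (f z))) * area_average (carleson_square I) (\<lambda>z. exp (- Re (f z)))"
      by (intro area_product_ge_one[OF f] sets_carleson_square sets_circle_arc I carleson_square_subset
          emeasure_carleson_square_pos[OF sets_circle_arc emeasure_arc_measure])
    also have "\<dots> \<le> ?S \<delta>"
      using I by (intro SUP_upper) (auto simp: carleson_squares_def)
    finally show ?thesis using a by simp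
  qed
  then show "\<forall>\<^sub>F \<delta> in at_right 0. a < ?S \<delta>"
    unfolding eventually_at_right_field by (intro exI[of _ 1]) simp
next
  \<comment> \<open>Above 1: first \<open>K\<close> is chosen so small that the bound on the
    products is below \<open>a\<close>, then the annulus where the derivative obeys
    \<open>K\<close>, then the size of the squares.\<close>
  fix a :: ennreal assume a: "1 < a"
  have "((\<lambda>K::real. (exp (K / 2) * (1 + 6 * K))\<^sup>2) \<longlongrightarrow> (exp (0 / 2) * (1 + 6 * 0))\<^sup>2) (at_right 0)"
    by (intro tendsto_intros) auto
  then have "((\<lambda>K::real. ennreal ((exp (K / 2) * (1 + 6 * K))\<^sup>2)) \<longlongrightarrow> ennreal 1) (at_right 0)"
    by (intro tendsto_ennrealI) simp
  then have "\<forall>\<^sub>F K in at_right 0. ennreal ((exp (K / 2) * (1 + 6 * K))\<^sup>2) < a"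
    using a by (intro order_tendstoD(2)) auto
  moreover have "\<forall>\<^sub>F K in at_right (0::real). 0 < K \<and> K \<le> 1 / 2"
    by (auto simp: eventually_at_right_field intro: exI[of _ "1/2"])
  ultimately have "\<forall>\<^sub>F K in at_right 0. ennreal ((exp (K / 2) * (1 + 6 * K))\<^sup>2) < a \<and> 0 < K \<and> K \<le> 1 / 2"
    by (rule eventually_conj)
  then obtain K where K: "ennreal ((exp (K / 2) * (1 + 6 * K))\<^sup>2) < a" "0 < K" "K \<le> 1 / 2"
    using eventually_happens'[OF trivial_limit_at_right_real] by blast
  obtain R where R: "R < 1" "\<And>z. z \<in> unit_disc \<Longrightarrow> R < cmod z \<Longrightarrow> (1 - cmod z) * cmod (deriv f z) \<le> K"
    using lb[unfolded little_bloch_iff[OF f]] K(2) by blast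
  \<comment> \<open>For arcs shorter than \<open>x\<close> the window \<open>2 * l\<close> of
    \<open>area_average_exp_product_le\<close> stays inside the annulus
    \<open>R < cmod z\<close>.\<close>
  define x where "x = min 1 ((1 - R) / 2)"
  have x: "0 < x" "x \<le> 1" "2 * x \<le> 1 - R" using R(1) by (auto simp: x_def min_def)
  have "?S \<delta> < a" if \<delta>: "\<delta> < x\<^sup>2 / (2 * pi)" for \<delta>
  proof -
    have "?S \<delta> \<le> ennreal ((exp (K / 2) * (1 + 6 * K))\<^sup>2)"
    proof (rule SUP_least)
      fix Q assume "Q \<in> {Q \<in> carleson_squares. measure disc_area Q < \<delta>}"
      then obtain I where I: "I \<in> circle_arcs" "Q = carleson_square I" "measure disc_area (carleson_square I) < \<delta>"
        by (auto simp: carleson_squares_def)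
      have "measure circle_measure I < x"
        using I \<delta> x by (intro measure_circle_less_of_carleson_square) auto
      then have "(1 - cmod z) * cmod (deriv f z) \<le> K"
        if "z \<in> unit_disc" "1 - cmod z < 2 * measure circle_measure I" for z
        using that x by (intro R(2)) auto
      then show "area_average Q (\<lambda>z. exp (Re (f z))) * area_average Q (\<lambda>z. exp (- Re (f z)))
          \<le> ennreal ((exp (K / 2) * (1 + 6 * K))\<^sup>2)"
        unfolding I(2) using K by (intro area_average_exp_product_le(1)[OF f I(1)]) auto
    qed
    also have "\<dots> < a" by (rule K(1))
    finally show ?thesis .
  qed
  moreover have "0 < x\<^sup>2 / (2 * pi)" using x by simp
  ultimately show "\<forall>\<^sub>F \<delta> in at_right 0. ?S \<delta> < a"
    unfolding eventually_at_right_field by blast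
qed

lemma little_bloch_of_product_tendsto_one:
  assumes f: "f holomorphic_on unit_disc"
    and lim: "((\<lambda>\<delta>::real. SUP Q\<in>{Q \<in> carleson_squares. measure disc_area Q < \<delta>}.
      area_average Q (\<lambda>z. exp (Re (f z))) * area_average Q (\<lambda>z. exp (- Re (f z)))) \<longlongrightarrow> 1) (at_right 0)"
    (is "(?S \<longlongrightarrow> 1) _")
  shows "f \<in> little_bloch"
  unfolding little_bloch_iff[OF f]
proof (intro allI impI)
  fix e :: real assume e: "0 < e"
  \<comment> \<open>Chosen so that the bound \<open>32 * sqrt (p - 1)\<close> is exactly
    \<open>e\<close>.\<close>
  define p where "p = 1 + (e / 32)\<^sup>2"
  have "1 < ennreal p"
    using e by (simp add: p_def ennreal_1[symmetric] del: ennreal_1) 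
  with lim have "\<forall>\<^sub>F \<delta> in at_right 0. ?S \<delta> < ennreal p"
    by (rule order_tendstoD(2))
  then obtain b where b: "0 < b" "\<And>\<delta>. 0 < \<delta> \<Longrightarrow> \<delta> < b \<Longrightarrow> ?S \<delta> < ennreal p"
    unfolding eventually_at_right_field by blast
  \<comment> \<open>For \<open>1 - cmod z < b / 8\<close> the arc of length
    \<open>4 * (1 - cmod z)\<close> is shorter than \<open>b / 2\<close>, and so the area of its
    square is below \<open>b / 2\<close> too.\<close>
  define R where "R = max (3 / 4) (1 - b / 8)"
  have "(1 - cmod z) * cmod (deriv f z) \<le> e" if z: "z \<in> unit_disc" "R < cmod z" for z
  proof -
    have "(1 - cmod z) * cmod (deriv f z) \<le> 32 * sqrt (p - 1)"
    proof (rule bloch_bound_of_area_product(2)[OF f])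
      fix I assume I: "I \<in> circle_arcs" "measure circle_measure I = 4 * (1 - cmod z)"
      have "measure disc_area (carleson_square I) < b / 2"
        using measure_carleson_square_less[OF I(1)] I(2) z by (auto simp: R_def)
      then have "area_average (carleson_square I) (\<lambda>z. exp (Re (f z))) * area_average (carleson_square I) (\<lambda>z. exp (- Re (f z)))
          \<le> ?S (b / 2)"
        using I(1) by (intro SUP_upper) (auto simp: carleson_squares_def)
      also have "\<dots> \<le> ennreal p"
        using b(2)[of "b / 2"] b(1) by simp
      finally show "area_average (carleson_square I) (\<lambda>z. exp (Re (f z))) *
          area_average (carleson_square I) (\<lambda>z. exp (- Re (f z))) \<le> ennreal p" .
    qed (use z in \<open>auto simp: R_def\<close>)
    also have "\<dots> = e" using e by (simp add: p_def)
    finally show ?thesis .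
  qed
  moreover have "R < 1" using b(1) by (simp add: R_def)
  ultimately show "\<exists>R<1. \<forall>z\<in>unit_disc. R < cmod z \<longrightarrow> (1 - cmod z) * cmod (deriv f z) \<le> e"
    by blast
qed

theorem proposition2p5:
  fixes f :: "complex \<Rightarrow> complex"
  assumes "f holomorphic_on unit_disc"
  shows "(f \<in> bloch \<longleftrightarrow> (\<exists>\<delta>>0. B2_weight (\<lambda>z. exp (\<delta> * Re (f z))))) \<and>
         (f \<in> little_bloch \<longleftrightarrow>
           ((\<lambda>\<delta>::real. SUP Q\<in>{Q \<in> carleson_squares. measure disc_area Q < \<delta>}.
               area_average Q (\<lambda>z. exp (Re (f z))) * area_average Q (\<lambda>z. exp (- Re (f z))))
             \<longlongrightarrow> 1) (at_right 0))"
  using B2_weight_exp_of_bloch bloch_of_B2_weight_exp[OF assms]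
    product_tendsto_one_of_little_bloch[OF assms] little_bloch_of_product_tendsto_one[OF assms]
  by blast

end
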